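(* Let $n\ge2$ be an integer. (1) Let $\omega\in L^1_{H_2}(\mathbb{R})$ with $\omega\neq0$. Then $\omega$ gives rise to a P\'olya ensemble on $H_2$ if and only if $\omega$ is a P\'olya frequency function of order $n$. (2) Let $\omega\in L^1_G(\mathbb{R}_+)$ with $\omega\neq0$. Then $\omega$ gives rise to a P\'olya ensemble on $G$ if and only if the function $\tilde\omega(x):=\omega(e^{-x})e^{-x}$, $x\in\mathbb{R}$, is a P\'olya frequency function of order $n$.
   Context: $\mathbb{R}_+=(0,\infty)$, $\Delta_n(a)=\prod_{1\le b<c\le n}(a_c-a_b)$. $H_2$ is the space of Hermitian $n\times n$ matrices, on which $\mathrm{U}(n)$ acts by conjugation; $G=\mathrm{GL}(n,\mathbb{C})$, on which $\mathrm{U}(n)\times\mathrm{U}(n)$ acts by $(k_1,k_2).g=k_1gk_2^*$. Reference measures are Lebesgue measures on the independent real matrix entries. A matrix density is called invariant if it is invariant under the respective group action. For $\mathcal N\in\{\mathbb{R},\mathbb{R}_+\}$, $L^1_{[1,n]}(\mathcal N)$ is the set of $f\in L^1(\mathcal N)$ with $\int_{\mathcal N}|x|^{\kappa-1}|f(x)|dx<\infty$ for all $\kappa\in[1,n]$. $L^1_{H_2}(\mathbb{R})$: the set of $f\in L^1(\mathbb{R})$ that are non-negative, $(n-1)$-times differentiable, with $\frac{\partial^jf}{\partial x^j}\in L^1_{[1,n]}(\mathbb{R})$ for $j=0,\dots,n-1$. $L^1_G(\mathbb{R}_+)$: the set of $f\in L^1(\mathbb{R}_+)$ that are non-negative, $(n-1)$-times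 differentiable, with $\big(x\frac{\partial}{\partial x}\big)^jf\in L^1_{[1,n]}(\mathbb{R}_+)$ for $j=0,\dots,n-1$. P\'olya ensemble on $H_2$ with weight $\omega\in L^1_{H_2}(\mathbb{R})$: a probability measure on $H_2$ with invariant density whose induced symmetrized joint eigenvalue density on $\mathbb{R}^n$ is $p(a)=C\,\Delta_n(a)\det[w_b(a_c)]_{b,c=1}^n\ge0$ with $w_j(x)=\big(-\frac{\partial}{\partial x}\big)^{j-1}\omega(x)$ and normalization constant $C>0$. P\'olya ensemble on $G$ with weight $\omega\in L^1_G(\mathbb{R}_+)$: a probability measure on $G$ with invariant density whose induced symmetrized joint density of the squared singular values on $\mathbb{R}_+^n$ is $p(a)=C\,\Delta_n(a)\det[w_b(a_c)]_{b,c=1}^n\ge0$ with $w_j(x)=\big(-x\frac{\partial}{\partial x}\big)^{j-1}\omega(x)$ and normalization constant $C>0$. (In both cases every symmetric probability density on $\mathbb{R}^n$, resp. $\mathbb{R}_+^n$, is induced by exactly one invariant matrix density.) One says that $\omega$ gives rise to a P\'olya ensemble if there is a constant $C>0$ such that the corresponding function $p$ is a (non-negative) probability density. A measurable function $f:\mathbb{R}\to\mathbb{R}$ is a P\'olya frequency function of order $N\in\mathbb{N}$ if $\Delta_m(x)\Delta_m(y)\det[f(x_b-y_c)]_{b,c=1,\dots,m}\ge0$ for all $m=1,\dots,N$ and all $x,y\in\mathbb{R}^m$. *)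

theory Defs
  imports "HOL-Analysis.Analysis" "Jordan_Normal_Form.Determinant"
begin

text \<open>
  Families indexed by \<open>1, \<dots>, n\<close> on paper are indexed by \<open>0, \<dots>, n - 1\<close> here, and a point of
  \<open>n\<close>-dimensional space is a function on \<open>nat\<close> of which only the values at arguments below \<open>n\<close>
  matter. Lebesgue measure on that space is the product measure \<open>PiM {..<n} (\<lambda>_. lborel)\<close>.
\<close>

definition vandermonde :: "nat \<Rightarrow> (nat \<Rightarrow> real) \<Rightarrow> real" where
  "vandermonde n a = (\<Prod>c<n. \<Prod>b<c. a c - a b)"

definition det_of :: "nat \<Rightarrow> (nat \<Rightarrow> nat \<Rightarrow> real) \<Rightarrow> real" where
  "det_of n A = Determinant.det (Matrix.mat n n (\<lambda>(b, c). A b c))"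

subsection \<open>Function spaces\<close>

text \<open>
  A function on \<open>{0<..}\<close> is represented by a function on all reals whose values outside \<open>{0<..}\<close>
  are irrelevant. Elements of the \<open>L\<^sup>1\<close>-spaces are functions, not classes modulo null sets.
\<close>

definition L1_weighted :: "nat \<Rightarrow> real set \<Rightarrow> (real \<Rightarrow> real) set" where
  "L1_weighted n N = {f. set_integrable lborel N f \<and>
     (\<forall>\<kappa>\<in>{1..real n}. set_integrable lborel N (\<lambda>x. \<bar>x\<bar> powr (\<kappa> - 1) * \<bar>f x\<bar>))}"

text \<open>To be used for open \<open>S\<close>, where \<^const>\<open>deriv\<close> is the derivative within \<open>S\<close>.\<close>

definition times_differentiable_on :: "nat \<Rightarrow> (real \<Rightarrow> real) \<Rightarrow> real set \<Rightarrow> bool" where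
  "times_differentiable_on k f S \<longleftrightarrow> (\<forall>j<k. (deriv ^^ j) f differentiable_on S)"

definition L1_H2 :: "nat \<Rightarrow> (real \<Rightarrow> real) set" where
  "L1_H2 n = {f. set_integrable lborel UNIV f \<and> (\<forall>x. 0 \<le> f x) \<and>
     times_differentiable_on (n - 1) f UNIV \<and>
     (\<forall>j\<in>{0..n - 1}. (deriv ^^ j) f \<in> L1_weighted n UNIV)}"

definition L1_G :: "nat \<Rightarrow> (real \<Rightarrow> real) set" where
  "L1_G n = {f. set_integrable lborel {0<..} f \<and> (\<forall>x>0. 0 \<le> f x) \<and>
     times_differentiable_on (n - 1) f {0<..} \<and>
     (\<forall>j\<in>{0..n - 1}. ((\<lambda>g x. x * deriv g x) ^^ j) f \<in> L1_weighted n {0<..})}"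

subsection \<open>Polya ensembles\<close>

definition weights_H2 :: "(real \<Rightarrow> real) \<Rightarrow> nat \<Rightarrow> real \<Rightarrow> real" where
  "weights_H2 \<omega> j = ((\<lambda>g x. - deriv g x) ^^ j) \<omega>"

definition weights_G :: "(real \<Rightarrow> real) \<Rightarrow> nat \<Rightarrow> real \<Rightarrow> real" where
  "weights_G \<omega> j = ((\<lambda>g x. - x * deriv g x) ^^ j) \<omega>"

definition ensemble_density ::
    "nat \<Rightarrow> (nat \<Rightarrow> real \<Rightarrow> real) \<Rightarrow> real \<Rightarrow> (nat \<Rightarrow> real) \<Rightarrow> real" where
  "ensemble_density n w C a = C * vandermonde n a * det_of n (\<lambda>b c. w b (a c))"

definition probability_density_on :: "nat \<Rightarrow> real set \<Rightarrow> ((nat \<Rightarrow> real) \<Rightarrow> real) \<Rightarrow> bool" where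
  "probability_density_on n N p \<longleftrightarrow>
     (\<forall>a \<in> {..<n} \<rightarrow>\<^sub>E N. 0 \<le> p a) \<and>
     set_integrable (PiM {..<n} (\<lambda>_. lborel)) ({..<n} \<rightarrow>\<^sub>E N) p \<and>
     set_lebesgue_integral (PiM {..<n} (\<lambda>_. lborel)) ({..<n} \<rightarrow>\<^sub>E N) p = 1"

text \<open>
  Every symmetric probability density on the eigenvalues (on the squared singular values) is
  induced by exactly one invariant matrix density on the Hermitian \<open>n \<times> n\<close> matrices (on
  \<open>GL(n, \<complex>)\<close>). A weight is therefore said to give rise to a Polya ensemble when the function
  prescribed for the joint density is, for some \<open>C > 0\<close>, a probability density.
\<close>

definition gives_rise_to_polya_ensemble_H2 :: "nat \<Rightarrow> (real \<Rightarrow> real) \<Rightarrow> bool" where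
  "gives_rise_to_polya_ensemble_H2 n \<omega> \<longleftrightarrow>
     (\<exists>C>0. probability_density_on n UNIV (ensemble_density n (weights_H2 \<omega>) C))"

definition gives_rise_to_polya_ensemble_G :: "nat \<Rightarrow> (real \<Rightarrow> real) \<Rightarrow> bool" where
  "gives_rise_to_polya_ensemble_G n \<omega> \<longleftrightarrow>
     (\<exists>C>0. probability_density_on n {0<..} (ensemble_density n (weights_G \<omega>) C))"

subsection \<open>Polya frequency functions\<close>

definition polya_frequency_function :: "nat \<Rightarrow> (real \<Rightarrow> real) \<Rightarrow> bool" where
  "polya_frequency_function N f \<longleftrightarrow> f \<in> borel_measurable borel \<and>
     (\<forall>m\<in>{1..N}. \<forall>x y :: nat \<Rightarrow> real.
        0 \<le> vandermonde m x * vandermonde m y * det_of m (\<lambda>b c. f (x b - y c)))"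

end

theory Submission
  imports Defs "HOL-Probability.Distributions"
begin

text \<open>
  Write \<open>w\<^sub>j = (-d/dx)\<^sup>j \<omega>\<close>. If \<open>\<omega>\<close> is a Polya frequency function, letting the points \<open>y\<^sub>c\<close> coalesce
  turns \<open>det \<omega>(x\<^sub>b - y\<^sub>c)\<close> into \<open>det w\<^sub>b(a\<^sub>c)\<close>, so the density is non-negative. Conversely, integrating
  \<open>det w\<^sub>b(a\<^sub>c)\<close> over interlacing points gives the determinant of the next smaller order, hence
  non-negativity descends to all orders \<open>m \<le> n\<close>, and no order vanishes identically. By Andreief's
  identity, convolving \<open>\<omega>\<close> with a Gaussian makes all these determinants strictly positive. They are
  the Wronskians of the functions \<open>y \<mapsto> \<omega>(x\<^sub>b - y)\<close>, and positivity of all leading Wronskians implies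
  positivity of \<open>det \<omega>(x\<^sub>b - y\<^sub>c)\<close> by division and the mean value theorem; the Gaussian is then removed in the
  limit. The multiplicative case reduces to the additive one by \<open>x = exp u\<close>, which replaces the
  operator \<open>-d/du\<close> by \<open>1 - d/du\<close> and so changes the determinant only by row operations.
\<close>

section \<open>Determinants of functions\<close>

text \<open>The top weight, of order n - 1, is a derivative that is known to be integrable but may
  be discontinuous. A determinant that is nonzero at one point may therefore vanish almost
  everywhere as far as pointwise arguments can tell. So nonvanishing is carried by integrals over
  boxes, and the interlacing identity is used twice: it transports signs downwards and nonvanishing
  upwards. Smoothing is forced by the division step: non-negative Wronskians do not allow dividing
  by the first function. The Gaussian is chosen because det exp(-(x_i - s_j)^2) is strictly positive
  for increasing points, so in Andreief's integral this factor cannot hide the places where the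
  other determinant is nonzero. The signs in (-d/dx)^j make every derivative of y -> \<omega>(x - y)
  come out with a plus sign, so no orientation has to be tracked between densities and
  Wronskians.\<close>

lemma det_of_altdef:
  "det_of n A = (\<Sum>p | p permutes {..<n}. of_int (sign p) * (\<Prod>i<n. A i (p i)))"
proof -
  have "p i < n" if "p permutes {..<n}" "i < n" for p i
    using permutes_in_image[OF that(1), of i] that(2) by simp
  then show ?thesis
    unfolding det_of_def by (subst det_def'[of _ n]) (auto simp: lessThan_atLeast0 intro!: sum.cong prod.cong)
qed

lemma det_of_cong:
  assumes "\<And>i j. i < n \<Longrightarrow> j < n \<Longrightarrow> A i j = B i j"
  shows "det_of n A = det_of n B"
  unfolding det_of_def using assms by (intro arg_cong[where f = Determinant.det] eq_matI) auto

lemma det_of_transpose: "det_of n (\<lambda>i j. A j i) = det_of n A"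
proof -
  have "Matrix.mat n n (\<lambda>(b, c). A c b) = (Matrix.mat n n (\<lambda>(b, c). A b c))\<^sup>T"
    by (intro eq_matI) auto
  then show ?thesis
    unfolding det_of_def by (simp add: Determinant.det_transpose[of _ n])
qed

lemma det_of_mult: "det_of n (\<lambda>i j. \<Sum>k<n. A i k * B k j) = det_of n A * det_of n B"
proof -
  have "Matrix.mat n n (\<lambda>(i, j). \<Sum>k<n. A i k * B k j) =
      Matrix.mat n n (\<lambda>(b, c). A b c) * Matrix.mat n n (\<lambda>(b, c). B b c)"
    by (intro eq_matI) (auto simp: scalar_prod_def lessThan_atLeast0)
  then show ?thesis
    unfolding det_of_def by (simp add: Determinant.det_mult[of _ n])
qed

lemma det_of_lower_triangular:
  assumes "\<And>i j. i < j \<Longrightarrow> j < n \<Longrightarrow> A i j = 0"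
  shows "det_of n A = (\<Prod>i<n. A i i)"
proof -
  have "det_of n A = prod_list (diag_mat (Matrix.mat n n (\<lambda>(b, c). A b c)))"
    unfolding det_of_def by (rule det_lower_triangular[of n]) (use assms in auto)
  also have "\<dots> = (\<Prod>i<n. A i i)"
    by (simp add: diag_mat_def prod.list_conv_set_nth lessThan_atLeast0)
  finally show ?thesis .
qed

text \<open>The new matrix is a lower triangular matrix times \<open>A\<close>. Row operations of
  this shape recur throughout: the Leibniz rule for quotients, finite differences, and the passage
  between -d/du and 1 - d/du.\<close>

lemma det_of_lower_comb:
  "det_of n (\<lambda>i j. \<Sum>k\<le>i. L i k * A k j) = (\<Prod>i<n. L i i) * det_of n A"
proof -
  define L' where "L' i k = (if k \<le> i then L i k else 0)" for i k :: nat
  have "det_of n (\<lambda>i j. \<Sum>k\<le>i. L i k * A k j) = det_of n (\<lambda>i j. \<Sum>k<n. L' i k * A k j)"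
    by (intro det_of_cong sum.mono_neutral_cong_left) (auto simp: L'_def)
  also have "\<dots> = det_of n L' * det_of n A"
    by (rule det_of_mult)
  also have "det_of n L' = (\<Prod>i<n. L i i)"
    by (subst det_of_lower_triangular) (auto simp: L'_def)
  finally show ?thesis .
qed

lemma det_of_scale_rows: "det_of n (\<lambda>i j. c i * A i j) = (\<Prod>i<n. c i) * det_of n A"
  unfolding det_of_altdef by (simp add: prod.distrib sum_distrib_left mult_ac)

lemma det_of_scale_cols: "det_of n (\<lambda>i j. c j * A i j) = (\<Prod>i<n. c i) * det_of n A"
  using det_of_scale_rows[of n c "\<lambda>i j. A j i"] det_of_transpose[of n A]
    det_of_transpose[of n "\<lambda>i j. c j * A i j"] by simp

lemma det_of_permute_cols:
  assumes p: "p permutes {..<n}"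
  shows "det_of n (\<lambda>i j. A i (p j)) = of_int (sign p) * det_of n A"
proof -
  have *: "p i < n" if "i < n" for i
    using permutes_in_image[OF p, of i] that by simp
  have "det_of n (\<lambda>i j. A j (p i)) = of_int (sign p) * det_of n (\<lambda>i j. A j i)"
  proof -
    have "det_of n (\<lambda>i j. A j (p i)) =
        Determinant.det (Matrix.mat n n (\<lambda>(i, j). Matrix.mat n n (\<lambda>(i, j). A j i) $$ (p i, j)))"
      unfolding det_of_def by (intro arg_cong[where f = Determinant.det] eq_matI) (auto simp: *)
    also have "\<dots> = of_int (sign p) * det_of n (\<lambda>i j. A j i)"
      unfolding det_of_def by (subst det_permute_rows) (use p in \<open>auto simp: lessThan_atLeast0\<close>)
    finally show ?thesis .
  qed
  then show ?thesis
    using det_of_transpose[of n A] det_of_transpose[of n "\<lambda>i j. A i (p j)"] by simp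
qed

lemma det_of_eq_cols:
  assumes "i < n" "j < n" "i \<noteq> j" "\<And>k. k < n \<Longrightarrow> A k i = A k j"
  shows "det_of n A = 0"
  unfolding det_of_def
  by (rule det_identical_columns[of _ n i j]) (use assms in \<open>auto intro!: eq_vecI\<close>)

lemma det_of_not_inj:
  assumes "\<not> inj_on s {..<n}"
  shows "det_of n (\<lambda>i j. f i (s j)) = 0"
proof -
  from assms obtain i j where "i < n" "j < n" "i \<noteq> j" "s i = s j"
    by (auto simp: inj_on_def)
  then show ?thesis
    by (intro det_of_eq_cols[of i n j]) auto
qed

lemma det_of_Suc_first_row:
  assumes "\<And>j. 0 < j \<Longrightarrow> j \<le> n \<Longrightarrow> A 0 j = 0"
  shows "det_of (Suc n) A = A 0 0 * det_of n (\<lambda>i j. A (Suc i) (Suc j))"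
proof -
  define M where "M = Matrix.mat (Suc n) (Suc n) (\<lambda>(b, c). A b c)"
  have "det_of (Suc n) A = (\<Sum>j<Suc n. M $$ (0, j) * cofactor M 0 j)"
    unfolding det_of_def M_def[symmetric] by (rule laplace_expansion_row) (auto simp: M_def)
  also have "\<dots> = (\<Sum>j\<in>{0}. M $$ (0, j) * cofactor M 0 j)"
    by (rule sum.mono_neutral_right) (auto simp: M_def assms)
  also have "\<dots> = A 0 0 * Determinant.det (mat_delete M 0 0)"
    by (simp add: cofactor_def M_def)
  also have "mat_delete M 0 0 = Matrix.mat n n (\<lambda>(i, j). A (Suc i) (Suc j))"
    by (intro eq_matI) (auto simp: mat_delete_def M_def)
  finally show ?thesis
    by (simp add: det_of_def)
qed

lemma det_of_Suc_last_col:
  assumes "\<And>i. 0 < i \<Longrightarrow> i \<le> n \<Longrightarrow> A i n = 0"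
  shows "det_of (Suc n) A = (-1) ^ n * A 0 n * det_of n (\<lambda>i j. A (Suc i) j)"
proof -
  define M where "M = Matrix.mat (Suc n) (Suc n) (\<lambda>(b, c). A b c)"
  have "det_of (Suc n) A = (\<Sum>i<Suc n. M $$ (i, n) * cofactor M i n)"
    unfolding det_of_def M_def[symmetric] by (rule laplace_expansion_column) (auto simp: M_def)
  also have "\<dots> = (\<Sum>i\<in>{0}. M $$ (i, n) * cofactor M i n)"
    by (rule sum.mono_neutral_right) (auto simp: M_def assms)
  also have "\<dots> = (-1) ^ n * A 0 n * Determinant.det (mat_delete M 0 n)"
    by (simp add: cofactor_def M_def)
  also have "mat_delete M 0 n = Matrix.mat n n (\<lambda>(i, j). A (Suc i) j)"
    by (intro eq_matI) (auto simp: mat_delete_def M_def)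
  finally show ?thesis
    by (simp add: det_of_def)
qed

lemma det_of_0 [simp]: "det_of 0 A = 1"
  by (simp add: det_of_def)

lemma det_of_1 [simp]: "det_of (Suc 0) A = A 0 0"
  using det_of_Suc_first_row[of 0 A] by simp

text \<open>The coefficients are the cofactors along column \<open>k\<close>, which do not involve
  that column. With the other columns frozen, the determinant becomes a fixed linear combination,
  open to one-variable calculus.\<close>

lemma det_of_linear_col:
  assumes "k < n"
  obtains \<kappa> where "\<And>x. det_of n (\<lambda>i j. if j = k then x i else A i j) = (\<Sum>i<n. x i * \<kappa> i)"
proof
  fix x :: "nat \<Rightarrow> real"
  let ?M = "\<lambda>x. Matrix.mat n n (\<lambda>(i, j). if j = k then x i else A i j)"
  have "det_of n (\<lambda>i j. if j = k then x i else A i j) = (\<Sum>i<n. ?M x $$ (i, k) * cofactor (?M x) i k)"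
    unfolding det_of_def by (rule laplace_expansion_column) (use assms in auto)
  also have "\<dots> = (\<Sum>i<n. x i * cofactor (?M (\<lambda>_. 0)) i k)"
  proof (intro sum.cong refl)
    fix i assume i: "i \<in> {..<n}"
    have "mat_delete (?M x) i k = mat_delete (?M (\<lambda>_. 0)) i k"
      by (intro eq_matI) (use i assms in \<open>auto simp: mat_delete_def\<close>)
    then show "?M x $$ (i, k) * cofactor (?M x) i k = x i * cofactor (?M (\<lambda>_. 0)) i k"
      using i assms by (simp add: cofactor_def)
  qed
  finally show "det_of n (\<lambda>i j. if j = k then x i else A i j)
      = (\<Sum>i<n. x i * cofactor (?M (\<lambda>_. 0)) i k)" .
qed

lemma det_of_diff_cols:
  "det_of n (\<lambda>i j. if j = 0 then A i 0 else A i j - A i (j - 1)) = det_of n A"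
proof -
  define L :: "nat \<Rightarrow> nat \<Rightarrow> real" where
    "L j k = (if k = j then 1 else if Suc k = j then -1 else 0)" for j k
  have *: "(\<Sum>k\<le>j. L j k * A i k) = (if j = 0 then A i 0 else A i j - A i (j - 1))" for i j
  proof (cases j)
    case (Suc j')
    have "(\<Sum>k\<le>j. L j k * A i k) = (\<Sum>k\<in>{j', j}. L j k * A i k)"
      by (rule sum.mono_neutral_right) (auto simp: Suc L_def)
    then show ?thesis
      by (simp add: Suc L_def)
  qed (simp add: L_def)
  have "det_of n (\<lambda>j i. \<Sum>k\<le>j. L j k * A i k) = det_of n (\<lambda>j i. A i j)"
    using det_of_lower_comb[of n L "\<lambda>j i. A i j"] by (simp add: L_def)
  then show ?thesis
    unfolding * using det_of_transpose[of n A]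
      det_of_transpose[of n "\<lambda>j i. if j = 0 then A i 0 else A i j - A i (j - 1)"] by simp
qed

lemma det_of_diff_rows:
  "det_of n (\<lambda>i j. if i = 0 then A 0 j else A i j - a * A (i - 1) j) = det_of n A"
proof -
  define L :: "nat \<Rightarrow> nat \<Rightarrow> real" where
    "L j k = (if k = j then 1 else if Suc k = j then -a else 0)" for j k
  have *: "(\<Sum>k\<le>i. L i k * A k j) = (if i = 0 then A 0 j else A i j - a * A (i - 1) j)" for i j
  proof (cases i)
    case (Suc i')
    have "(\<Sum>k\<le>i. L i k * A k j) = (\<Sum>k\<in>{i', i}. L i k * A k j)"
      by (rule sum.mono_neutral_right) (auto simp: Suc L_def)
    then show ?thesis
      by (simp add: Suc L_def)
  qed (simp add: L_def)
  show ?thesis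
    using det_of_lower_comb[of n L A] unfolding * by (simp add: L_def)
qed

section \<open>Vandermonde determinants and sorting of the points\<close>

lemma vandermonde_eq_det: "vandermonde n a = det_of n (\<lambda>i j. a j ^ i)"
proof (induction n)
  case 0
  show ?case by (simp add: vandermonde_def)
next
  case (Suc n)
  \<comment> \<open>Subtracting \<open>a n\<close> times the preceding row turns the last column
    into (1, 0, ..., 0) and leaves a factor \<open>a j - a n\<close> in each other column; the sign
    of the corner expansion reverses these \<open>n\<close> factors.\<close>
  let ?B = "\<lambda>i j. if i = 0 then 1 else a j ^ i - a n * a j ^ (i - 1)"
  have "det_of (Suc n) (\<lambda>i j. a j ^ i) = det_of (Suc n) ?B"
    using det_of_diff_rows[of "Suc n" "\<lambda>i j. a j ^ i" "a n", symmetric]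
    by (simp only: power_0)
  also have "\<dots> = (-1) ^ n * ?B 0 n * det_of n (\<lambda>i j. ?B (Suc i) j)"
    by (rule det_of_Suc_last_col) (auto simp: power_eq_if)
  also have "(\<lambda>i j. ?B (Suc i) j) = (\<lambda>i j. (a j - a n) * a j ^ i)"
    by (auto simp: algebra_simps)
  also have "(-1) ^ n * ?B 0 n * det_of n \<dots>
      = ((\<Prod>j<n. -1) * (\<Prod>j<n. a j - a n)) * det_of n (\<lambda>i j. a j ^ i)"
    by (simp add: det_of_scale_cols)
  also have "(\<Prod>j<n. -1) * (\<Prod>j<n. a j - a n) = (\<Prod>j<n. a n - a j)"
    by (subst prod.distrib[symmetric]) simp
  finally show ?case
    using Suc by (simp add: vandermonde_def mult_ac)
qed

lemma vandermonde_pos: "strict_mono_on {..<n} a \<Longrightarrow> 0 < vandermonde n a"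
  unfolding vandermonde_def by (intro prod_pos) (auto simp: strict_mono_on_def)

lemma sorting_permutation:
  fixes s :: "nat \<Rightarrow> real"
  assumes "inj_on s {..<n}"
  obtains p where "p permutes {..<n}" "strict_mono_on {..<n} (\<lambda>j. s (p j))"
proof -
  define M where "M = s ` {..<n}"
  have "card M = n" "finite M"
    using card_image[OF assms] by (auto simp: M_def)
  define h where "h j = sorted_list_of_set M ! j" for j
  have "bij_betw h {..<n} M"
    unfolding h_def using bij_betw_nth[of "sorted_list_of_set M" "{..<n}" M] \<open>card M = n\<close> \<open>finite M\<close>
    by simp
  moreover have "strict_mono_on {..<n} h"
    using sorted_wrt_nth_less[OF strict_sorted_list_of_set[of M]] \<open>card M = n\<close>
    by (auto simp: strict_mono_on_def h_def)
  ultimately have h: "bij_betw h {..<n} M" "strict_mono_on {..<n} h" by auto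
  define q where "q = inv_into {..<n} s"
  have "bij_betw q M {..<n}"
    unfolding q_def M_def by (intro bij_betw_inv_into inj_on_imp_bij_betw assms)
  then have qh: "bij_betw (q \<circ> h) {..<n} {..<n}"
    using h(1) by (rule bij_betw_trans[rotated])
  \<comment> \<open>The identity beyond \<open>n\<close>, as \<open>permutes\<close>
    demands.\<close>
  define p where "p j = (if j < n then q (h j) else j)" for j
  have "bij_betw p {..<n} {..<n}"
    using qh by (subst bij_betw_cong[of _ _ "q \<circ> h"]) (auto simp: p_def)
  then have 1: "p permutes {..<n}"
    by (intro bij_imp_permutes) (auto simp: p_def)
  have "s (p j) = h j" if "j < n" for j
  proof -
    have "h j \<in> M" using h(1) that by (auto simp: bij_betw_def)
    then show ?thesis using that by (simp add: p_def q_def M_def f_inv_into_f)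
  qed
  with h(2) have "strict_mono_on {..<n} (\<lambda>j. s (p j))"
    by (auto simp: strict_mono_on_def)
  with 1 that show thesis by blast
qed

text \<open>Permuting the points multiplies both determinants by the same sign, so their product is
  symmetric; coinciding points give equal columns and the product 0.\<close>

lemma det_prod_nonneg_if_sorted:
  assumes "\<And>s. strict_mono_on {..<n} s \<Longrightarrow>
    0 \<le> K * (det_of n (\<lambda>i j. f i (s j)) * det_of n (\<lambda>i j. g i (s j)))"
  shows "0 \<le> K * (det_of n (\<lambda>i j. f i (s j :: real)) * det_of n (\<lambda>i j. g i (s j)))"
proof (cases "inj_on s {..<n}")
  case True
  then obtain p where p: "p permutes {..<n}" "strict_mono_on {..<n} (\<lambda>j. s (p j))"
    by (rule sorting_permutation)
  have "0 \<le> K * (det_of n (\<lambda>i j. f i (s (p j))) * det_of n (\<lambda>i j. g i (s (p j))))"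
    by (rule assms[OF p(2)])
  also have "\<dots> = K * (det_of n (\<lambda>i j. f i (s j)) * det_of n (\<lambda>i j. g i (s j)))"
    using det_of_permute_cols[OF p(1), of "\<lambda>i j. f i (s j)"]
      det_of_permute_cols[OF p(1), of "\<lambda>i j. g i (s j)"]
    by (auto simp: sign_def)
  finally show ?thesis .
qed (simp add: det_of_not_inj)

text \<open>The Vandermonde factor is itself a determinant in the same points, so the symmetric
  condition reduces to increasing points. The constant \<open>K\<close> carries along the
  Vandermonde factor of a second family of points.\<close>

lemma vandermonde_det_nonneg_iff:
  "(\<forall>s. 0 \<le> vandermonde n s * (K * det_of n (\<lambda>i j. f i (s j))))
    \<longleftrightarrow> (\<forall>s. strict_mono_on {..<n} s \<longrightarrow> 0 \<le> K * det_of n (\<lambda>i j. f i (s j :: real)))"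
    (is "?L \<longleftrightarrow> ?R")
proof
  assume ?L
  then show ?R
    using vandermonde_pos by (metis zero_le_mult_iff not_less)
next
  assume R: ?R
  have "0 \<le> K * (det_of n (\<lambda>i j. s j ^ i) * det_of n (\<lambda>i j. f i (s j)))" for s
  proof (rule det_prod_nonneg_if_sorted)
    fix s :: "nat \<Rightarrow> real" assume s: "strict_mono_on {..<n} s"
    have "0 \<le> vandermonde n s * (K * det_of n (\<lambda>i j. f i (s j)))"
      using R s by (intro mult_nonneg_nonneg[OF less_imp_le[OF vandermonde_pos[OF s]]]) blast
    then show "0 \<le> K * (det_of n (\<lambda>i j. s j ^ i) * det_of n (\<lambda>i j. f i (s j)))"
      by (simp add: vandermonde_eq_det mult_ac)
  qed
  then show ?L by (simp add: vandermonde_eq_det mult_ac)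
qed

lemma tendsto_det_of:
  assumes "\<And>i j. i < n \<Longrightarrow> j < n \<Longrightarrow> ((\<lambda>t. A t i j) \<longlongrightarrow> B i j) F"
  shows "((\<lambda>t. det_of n (A t)) \<longlongrightarrow> det_of n B) F"
proof -
  have "p i < n" if "p permutes {..<n}" "i < n" for p i
    using permutes_in_image[OF that(1), of i] that(2) by simp
  then show ?thesis
    unfolding det_of_altdef by (intro tendsto_intros assms) auto
qed

section \<open>Positivity of determinants from positivity of Wronskians\<close>

text \<open>The mean value theorem applied to single entries would give a different point in every
  row. It is applied to the determinant as a function of one column instead, so that all rows share
  the intermediate point.\<close>

lemma det_of_increments_pos:
  fixes h h' :: "nat \<Rightarrow> real \<Rightarrow> real"
  assumes h: "\<And>i t. i < n \<Longrightarrow> (h i has_real_derivative h' i t) (at t)"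
    and y: "strict_mono_on {..<Suc n} y"
    and pos: "\<And>s. strict_mono_on {..<n} s \<Longrightarrow> 0 < det_of n (\<lambda>i j. h' i (s j))"
  shows "0 < det_of n (\<lambda>i j. h i (y (Suc j)) - h i (y j))"
proof -
  \<comment> \<open>\<open>k\<close> counts the columns already turned from derivatives into
    increments. Points chosen in consecutive gaps of \<open>y\<close> are automatically increasing,
    which is what \<open>pos\<close> asks for.\<close>
  have "0 < det_of n (\<lambda>i j. if j < k then h i (y (Suc j)) - h i (y j) else h' i (s j))"
    if "k \<le> n" "\<And>j. j < n \<Longrightarrow> y j < s j \<and> s j < y (Suc j)" for k s
    using that
  proof (induction k arbitrary: s)
    case 0
    have "strict_mono_on {..<n} s"
    proof (rule strict_mono_onI)
      fix i j assume ij: "i \<in> {..<n}" "j \<in> {..<n}" "i < j"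
      have "y (Suc i) \<le> y j"
        using y ij by (cases "Suc i = j") (auto simp: strict_mono_on_def less_imp_le)
      then show "s i < s j"
        using 0(2)[of i] 0(2)[of j] ij by auto
    qed
    then show ?case using pos by simp
  next
    case (Suc k)
    define A where "A i j = (if j < k then h i (y (Suc j)) - h i (y j) else h' i (s j))" for i j
    from Suc.prems have k: "k < n" by simp
    obtain \<kappa> where \<kappa>: "\<And>x. det_of n (\<lambda>i j. if j = k then x i else A i j) = (\<Sum>i<n. x i * \<kappa> i)"
      using det_of_linear_col[OF k, of A] by blast
    define \<phi> where "\<phi> t = (\<Sum>i<n. h i t * \<kappa> i)" for t
    have d: "(\<phi> has_real_derivative (\<Sum>i<n. h' i t * \<kappa> i)) (at t)" for t
      unfolding \<phi>_def by (auto intro!: derivative_eq_intros h)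
    have "y k < y (Suc k)"
      using Suc.prems(2)[OF k] by simp
    then obtain z where z: "y k < z" "z < y (Suc k)"
        "\<phi> (y (Suc k)) - \<phi> (y k) = (y (Suc k) - y k) * (\<Sum>i<n. h' i z * \<kappa> i)"
      using MVT2[of "y k" "y (Suc k)" \<phi> "\<lambda>t. \<Sum>i<n. h' i t * \<kappa> i"] d by auto
    have "0 < det_of n (\<lambda>i j. if j < k then h i (y (Suc j)) - h i (y j) else h' i ((s(k := z)) j))"
      using Suc.prems z by (intro Suc.IH) auto
    also have "\<dots> = det_of n (\<lambda>i j. if j = k then h' i z else A i j)"
      by (intro det_of_cong) (auto simp: A_def)
    also have "\<dots> = (\<Sum>i<n. h' i z * \<kappa> i)"
      by (rule \<kappa>)
    finally have "0 < \<phi> (y (Suc k)) - \<phi> (y k)"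
      using z \<open>y k < y (Suc k)\<close> by simp
    also have "\<phi> (y (Suc k)) - \<phi> (y k) = (\<Sum>i<n. (h i (y (Suc k)) - h i (y k)) * \<kappa> i)"
      by (simp add: \<phi>_def sum_subtractf[symmetric] left_diff_distrib)
    also have "\<dots> = det_of n (\<lambda>i j. if j = k then h i (y (Suc k)) - h i (y k) else A i j)"
      by (rule \<kappa>[symmetric])
    also have "\<dots> = det_of n (\<lambda>i j. if j < Suc k then h i (y (Suc j)) - h i (y j) else h' i (s j))"
      by (intro det_of_cong) (auto simp: A_def less_Suc_eq)
    finally show ?case .
  qed
  \<comment> \<open>At \<open>k = n\<close> no derivative column is left; the midpoints merely fill
    the gaps.\<close>
  from this[of n "\<lambda>j. (y j + y (Suc j)) / 2"]
  have "0 < det_of n (\<lambda>i j. if j < n then h i (y (Suc j)) - h i (y j)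
      else h' i ((y j + y (Suc j)) / 2))"
    using y by (force simp: strict_mono_on_def)
  also have "\<dots> = det_of n (\<lambda>i j. h i (y (Suc j)) - h i (y j))"
    by (intro det_of_cong) auto
  finally show ?thesis .
qed

text \<open>
  If \<open>U k\<close> and \<open>G k\<close> are the \<open>k\<close>-th derivatives of two functions, then \<open>quotient_deriv U G k\<close>
  is the \<open>k\<close>-th derivative of their quotient: solve the Leibniz rule for the last derivative.
\<close>

fun quotient_deriv :: "(nat \<Rightarrow> real \<Rightarrow> real) \<Rightarrow> (nat \<Rightarrow> real \<Rightarrow> real) \<Rightarrow> nat \<Rightarrow> real \<Rightarrow> real" where
  "quotient_deriv U G k t =
     (U k t - (\<Sum>l<k. real (k choose l) * G (k - l) t * quotient_deriv U G l t)) / G 0 t"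

declare quotient_deriv.simps [simp del]

lemma quotient_deriv_Leibniz:
  assumes "G 0 t \<noteq> 0"
  shows "U k t = (\<Sum>l\<le>k. real (k choose l) * G (k - l) t * quotient_deriv U G l t)"
  using assms quotient_deriv.simps[of U G k t]
  by (simp add: lessThan_Suc_atMost[symmetric])

text \<open>Pascal's rule in the shape of the product rule. As \<open>g\<close> and \<open>h\<close>
  are arbitrary sequences, it also serves for powers of a shift minus the identity and for powers of
  an operator minus a constant.\<close>

lemma Leibniz_Suc:
  fixes g h :: "nat \<Rightarrow> real"
  shows "(\<Sum>l\<le>Suc k. real (Suc k choose l) * g (Suc k - l) * h l)
    = (\<Sum>l\<le>k. real (k choose l) * (g (Suc (k - l)) * h l + g (k - l) * h (Suc l)))"
proof -
  have "(\<Sum>l\<le>Suc k. real (Suc k choose l) * g (Suc k - l) * h l)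
      = (g (Suc k) * h 0 + (\<Sum>l\<le>k. real (k choose Suc l) * g (k - l) * h (Suc l)))
        + (\<Sum>l\<le>k. real (k choose l) * g (k - l) * h (Suc l))"
    unfolding sum.atMost_Suc_shift by (simp add: algebra_simps sum.distrib)
  also have "g (Suc k) * h 0 + (\<Sum>l\<le>k. real (k choose Suc l) * g (k - l) * h (Suc l))
      = (\<Sum>l\<le>Suc k. real (k choose l) * g (Suc k - l) * h l)"
    unfolding sum.atMost_Suc_shift by simp
  also have "\<dots> = (\<Sum>l\<le>k. real (k choose l) * g (Suc (k - l)) * h l)"
    by (simp add: Suc_diff_le)
  finally show ?thesis
    by (simp add: algebra_simps sum.distrib)
qed

text \<open>The recursion shows that the \<open>k\<close>-th function has some derivative
  \<open>d\<close>. Differentiating the Leibniz identity of order \<open>k\<close> and comparing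
  with that of order \<open>Suc k\<close> leaves only the terms with factor \<open>G 0 t\<close>,
  which identifies \<open>d\<close>.\<close>

lemma has_derivative_quotient_deriv:
  assumes G: "\<And>k t. Suc k < N \<Longrightarrow> (G k has_real_derivative G (Suc k) t) (at t)"
    and U: "\<And>k t. Suc k < N \<Longrightarrow> (U k has_real_derivative U (Suc k) t) (at t)"
    and nz: "\<And>t. G 0 t \<noteq> 0"
    and k: "Suc k < N"
  shows "(quotient_deriv U G k has_real_derivative quotient_deriv U G (Suc k) t) (at t)"
  using k
proof (induction k rule: less_induct)
  case (less k)
  define H where "H = quotient_deriv U G"
  have H: "(H l has_real_derivative H (Suc l) t) (at t)" if "l < k" for l
    unfolding H_def using less that by simp
  have Udiff: "U l differentiable (at t)" and Gdiff: "G l differentiable (at t)" if "l \<le> k" for l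
    using that U[of l t] G[of l t] less.prems by (auto simp: real_differentiable_def)
  have Hdiff: "H l differentiable (at t)" if "l < k" for l
    using that H[of l] by (auto simp: real_differentiable_def)
  have "(\<lambda>t. (U k t - (\<Sum>l<k. real (k choose l) * G (k - l) t * H l t)) / G 0 t) differentiable (at t)"
    by (intro differentiable_divide differentiable_diff differentiable_sum ballI differentiable_mult
        differentiable_const Udiff Gdiff Hdiff nz) auto
  moreover have "H k = (\<lambda>t. (U k t - (\<Sum>l<k. real (k choose l) * G (k - l) t * H l t)) / G 0 t)"
    unfolding H_def by (rule ext) (rule quotient_deriv.simps)
  ultimately have "H k differentiable (at t)" by simp
  then obtain d where d: "(H k has_real_derivative d) (at t)"
    by (auto simp: real_differentiable_def)
  define h' where "h' l = (if l < k then H (Suc l) t else d)" for l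
  have h': "(H l has_real_derivative h' l) (at t)" if "l \<le> k" for l
    using that H[of l] d by (cases "l = k") (auto simp: h'_def)
  have "(U k has_real_derivative
      (\<Sum>l\<le>k. real (k choose l) * (G (Suc (k - l)) t * H l t + G (k - l) t * h' l))) (at t)"
  proof -
    have "U k = (\<lambda>t. \<Sum>l\<le>k. real (k choose l) * (G (k - l) t * H l t))"
      unfolding H_def using quotient_deriv_Leibniz[of G, OF nz, of U k]
      by (intro ext) (simp only: mult.assoc)
    moreover have "((\<lambda>t. \<Sum>l\<le>k. real (k choose l) * (G (k - l) t * H l t)) has_real_derivative
      (\<Sum>l\<le>k. real (k choose l) * (G (Suc (k - l)) t * H l t + G (k - l) t * h' l))) (at t)"
    proof (intro DERIV_sum DERIV_cmult)
      fix l assume "l \<in> {..k}"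
      then have "l \<le> k" "Suc (k - l) < N" using less.prems by auto
      from DERIV_mult[OF G[OF this(2)] h'[OF this(1)]]
      show "((\<lambda>t. G (k - l) t * H l t) has_real_derivative
          G (Suc (k - l)) t * H l t + G (k - l) t * h' l) (at t)"
        by (simp add: mult_ac)
    qed
    ultimately show ?thesis by simp
  qed
  then have "U (Suc k) t =
      (\<Sum>l\<le>k. real (k choose l) * (G (Suc (k - l)) t * H l t + G (k - l) t * h' l))"
    using U[OF less.prems, of t] by (rule DERIV_unique[OF _ , rotated])
  moreover have "U (Suc k) t =
      (\<Sum>l\<le>k. real (k choose l) * (G (Suc (k - l)) t * H l t + G (k - l) t * H (Suc l) t))"
    using quotient_deriv_Leibniz[of G, OF nz, of U "Suc k" t]
      Leibniz_Suc[of k "\<lambda>l. G l t" "\<lambda>l. H l t"] by (simp add: H_def)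
  ultimately have "d = H (Suc k) t"
    using nz[of t] by (simp add: lessThan_Suc_atMost[symmetric] h'_def)
  with d show ?case by (simp add: H_def)
qed

text \<open>Dividing all functions by the first one multiplies a Wronskian of order m by a positive
  factor and makes the first function 1. Its derivatives vanish, so what remains is a Wronskian of
  one order less, formed from the derivatives of the other quotients; the induction hypothesis
  treats these, and increments recover the quotients.\<close>

theorem det_of_pos_if_Wronskians_pos:
  assumes "\<And>i k t. i < n \<Longrightarrow> Suc k < n \<Longrightarrow> (U i k has_real_derivative U i (Suc k) t) (at t)"
    and "\<And>m t. 0 < m \<Longrightarrow> m \<le> n \<Longrightarrow> 0 < det_of m (\<lambda>i k. U i k t)"
    and "strict_mono_on {..<n} y"
  shows "0 < det_of n (\<lambda>i j. U i 0 (y j))"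
  using assms
proof (induction n arbitrary: U y)
  case (Suc n)
  note U = Suc.prems(1) and W = Suc.prems(2) and y = Suc.prems(3)
  define g where "g = U 0 0"
  have g: "0 < g t" for t
    using W[of 1 t] by (simp add: g_def)
  then have g0: "U 0 0 t \<noteq> 0" for t
    by (simp add: g_def less_imp_neq[symmetric])
  define H where "H i = quotient_deriv (U i) (U 0)" for i
  have H: "(H i k has_real_derivative H i (Suc k) t) (at t)" if "i < Suc n" "Suc k < Suc n" for i k t
    unfolding H_def by (rule has_derivative_quotient_deriv[where N = "Suc n"]) (use U that g0 in auto)
  have UH: "U i k t = (\<Sum>l\<le>k. (real (k choose l) * U 0 (k - l) t) * H i l t)" for i k t
    unfolding H_def by (rule quotient_deriv_Leibniz[where G = "U 0", OF g0])
  have H00: "H 0 0 t = 1" for t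
    using g0 quotient_deriv.simps[of "U 0" "U 0" 0 t] by (simp add: H_def)
  have H0: "H 0 (Suc k) t = 0" if "k < n" for k t
    using that
  proof (induction k arbitrary: t)
    case 0
    have "H 0 0 = (\<lambda>_. 1)" by (auto simp: H00)
    with H[of 0 0 t] 0 have "((\<lambda>_. 1) has_real_derivative H 0 (Suc 0) t) (at t)" by simp
    then show ?case by (rule DERIV_unique) simp
  next
    case (Suc k)
    then have "H 0 (Suc k) = (\<lambda>_. 0)" by auto
    with H[of 0 "Suc k" t] Suc.prems
    have "((\<lambda>_. 0) has_real_derivative H 0 (Suc (Suc k)) t) (at t)" by simp
    then show ?case by (rule DERIV_unique) simp
  qed
  define V where "V i k = H (Suc i) (Suc k)" for i k
  have V: "0 < det_of m (\<lambda>i k. V i k t)" if "m \<le> n" for m t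
  proof -
    have "0 < det_of (Suc m) (\<lambda>i k. U i k t)"
      using that by (intro W) auto
    also have "\<dots> = det_of (Suc m) (\<lambda>k i. U i k t)"
      by (rule det_of_transpose[symmetric])
    \<comment> \<open>By the Leibniz rule each row of derivatives is a combination of rows of
      quotient derivatives up to the same order, with diagonal coefficient
      \<open>g t\<close>.\<close>
    also have "\<dots> = (\<Prod>i<Suc m. g t) * det_of (Suc m) (\<lambda>k i. H i k t)"
      by (subst UH, subst det_of_lower_comb) (simp add: g_def)
    also have "det_of (Suc m) (\<lambda>k i. H i k t) = det_of (Suc m) (\<lambda>i k. H i k t)"
      by (rule det_of_transpose)
    also have "\<dots> = det_of m (\<lambda>i k. V i k t)"
      by (subst det_of_Suc_first_row) (use that H00 H0 in \<open>auto simp: V_def gr0_conv_Suc\<close>)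
    finally show ?thesis
      by (rule zero_less_mult_pos) (intro prod_pos, simp add: g)
  qed
  have "0 < det_of n (\<lambda>i j. H (Suc i) 0 (y (Suc j)) - H (Suc i) 0 (y j))"
  proof (rule det_of_increments_pos[where h' = "\<lambda>i. V i 0"])
    show "(H (Suc i) 0 has_real_derivative V i 0 t) (at t)" if "i < n" for i t
      unfolding V_def using that by (intro H) auto
    show "0 < det_of n (\<lambda>i j. V i 0 (s j))" if "strict_mono_on {..<n} s" for s
      by (rule Suc.IH) (use V that H in \<open>auto simp: V_def\<close>)
  qed (rule y)
  \<comment> \<open>Bordering by the constant quotient 1: its first value is 1 and all its
    increments are 0.\<close>
  also have "\<dots> = det_of (Suc n)
      (\<lambda>i j. if j = 0 then H i 0 (y 0) else H i 0 (y j) - H i 0 (y (j - 1)))"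
    by (subst det_of_Suc_first_row) (auto simp: H00)
  also have "\<dots> = det_of (Suc n) (\<lambda>i j. H i 0 (y j))"
    by (rule det_of_diff_cols)
  finally have "0 < (\<Prod>j<Suc n. g (y j)) * det_of (Suc n) (\<lambda>i j. H i 0 (y j))"
    using g by (intro mult_pos_pos prod_pos) auto
  also have "\<dots> = det_of (Suc n) (\<lambda>i j. U i 0 (y j))"
    by (subst det_of_scale_cols[symmetric], subst UH) (simp add: g_def)
  finally show ?case .
qed simp

section \<open>Strict positivity for the exponential and the Gaussian kernel\<close>

lemma det_of_exp_pos:
  assumes "strict_mono_on {..<n} x" "strict_mono_on {..<n} y"
  shows "0 < det_of n (\<lambda>i j. exp (x i * y j :: real))"
proof -
  have "0 < det_of n (\<lambda>i j. x i ^ 0 * exp (x i * y j))"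
  proof (rule det_of_pos_if_Wronskians_pos[where U = "\<lambda>i k t. x i ^ k * exp (x i * t)"])
    fix m :: nat and t assume "m \<le> n"
    then have "strict_mono_on {..<m} x"
      using assms(1) by (auto simp: strict_mono_on_def)
    \<comment> \<open>The Wronskian of exponentials is a Vandermonde determinant in the exponents,
      up to positive row factors.\<close>
    then have "0 < (\<Prod>i<m. exp (x i * t)) * det_of m (\<lambda>i k. x k ^ i)"
      using vandermonde_pos[of m x] by (intro mult_pos_pos prod_pos) (auto simp: vandermonde_eq_det)
    also have "\<dots> = det_of m (\<lambda>i k. x i ^ k * exp (x i * t))"
      using det_of_scale_rows[of m "\<lambda>i. exp (x i * t)" "\<lambda>i k. x i ^ k"]
        det_of_transpose[of m "\<lambda>i k. x i ^ k"] by (simp add: mult_ac)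
    finally show "0 < det_of m (\<lambda>i k. x i ^ k * exp (x i * t))" .
  qed (use assms in \<open>auto intro!: derivative_eq_intros\<close>)
  then show ?thesis by simp
qed

lemma det_of_Gauss_pos:
  assumes "strict_mono_on {..<n} x" "strict_mono_on {..<n} y" "0 < \<sigma>"
  shows "0 < det_of n (\<lambda>i j. exp (- (((x i - y j) / \<sigma>)\<^sup>2)) :: real)"
proof -
  \<comment> \<open>Expanding the square: the mixed term gives an exponential kernel, the two pure
    squares only scale rows and columns.\<close>
  have *: "exp (- (((x i - y j) / \<sigma>)\<^sup>2))
      = exp (- ((x i / \<sigma>)\<^sup>2)) * (exp (- ((y j / \<sigma>)\<^sup>2)) * exp ((2 / \<sigma>\<^sup>2 * x i) * y j))" for i j
    using assms(3) by (simp add: exp_add[symmetric] power2_eq_square field_simps)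
  have "0 < det_of n (\<lambda>i j. exp ((2 / \<sigma>\<^sup>2 * x i) * y j))"
    using assms by (intro det_of_exp_pos) (auto simp: strict_mono_on_def divide_strict_right_mono)
  then show ?thesis
    unfolding * det_of_scale_rows det_of_scale_cols by (intro mult_pos_pos prod_pos) auto
qed

section \<open>Integrals over the real line\<close>

lemma integrable_limit_at_bot_zero:
  fixes F :: "real \<Rightarrow> real"
  assumes int: "integrable lborel F" and lim: "(F \<longlongrightarrow> L) at_bot"
  shows "L = 0"
proof (rule ccontr)
  assume "L \<noteq> 0"
  define c where "c = \<bar>L\<bar> / 2"
  have "((\<lambda>x. \<bar>F x\<bar>) \<longlongrightarrow> \<bar>L\<bar>) at_bot"
    by (intro tendsto_intros lim)
  then have "\<forall>\<^sub>F x in at_bot. c < \<bar>F x\<bar>"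
    using \<open>L \<noteq> 0\<close> by (intro order_tendstoD(1)) (auto simp: c_def)
  then obtain N where N: "\<And>x. x \<le> N \<Longrightarrow> c < \<bar>F x\<bar>"
    by (auto simp: eventually_at_bot_linorder)
  \<comment> \<open>Markov's bound for the measure of the set where \<open>F\<close> is at least
    \<open>c\<close> in absolute value. That set contains a half-line, hence an interval of length
    \<open>r + 1\<close>.\<close>
  define r where "r = 1 / c * (\<integral>x. \<bar>F x\<bar> \<partial>lborel)"
  have "0 < c" using \<open>L \<noteq> 0\<close> by (simp add: c_def)
  then have "0 \<le> r" by (simp add: r_def)
  have "{N - (r + 1)..N} \<subseteq> {x \<in> space lborel. c \<le> \<bar>F x\<bar>}"
    using N by (auto intro: less_imp_le)
  moreover have "{x \<in> space lborel. c \<le> \<bar>F x\<bar>} \<in> sets lborel"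
    using borel_measurable_integrable[OF int] by measurable
  ultimately have "emeasure lborel {N - (r + 1)..N} \<le> emeasure lborel {x \<in> space lborel. c \<le> \<bar>F x\<bar>}"
    by (intro emeasure_mono)
  also have "\<dots> \<le> ennreal r"
    unfolding r_def using int \<open>0 < c\<close>
    by (intro integral_Markov_inequality) auto
  finally show False
    using \<open>0 \<le> r\<close> by (simp add: ennreal_le_iff)
qed

lemma integrable_limit_at_top_zero:
  fixes F :: "real \<Rightarrow> real"
  assumes "integrable lborel F" and "(F \<longlongrightarrow> L) at_top"
  shows "L = 0"
proof (rule integrable_limit_at_bot_zero)
  show "integrable lborel (\<lambda>x. F (- x))"
    using lborel_integrable_real_affine[OF assms(1), of "-1" 0] by simp
  show "((\<lambda>x. F (- x)) \<longlongrightarrow> L) at_bot"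
    using assms(2) by (simp add: filterlim_at_bot_mirror)
qed

lemma set_integrable_if_integrable:
  fixes f :: "'a \<Rightarrow> real"
  shows "integrable M f \<Longrightarrow> A \<in> sets M \<Longrightarrow> set_integrable M A f"
  unfolding set_integrable_def by (intro integrable_mult_indicator)

text \<open>
  The derivative need not be continuous; the fundamental theorem of calculus for the
  Henstock-Kurzweil integral copes with that.
\<close>

lemma
  fixes F :: "real \<Rightarrow> real"
  assumes der: "\<And>x. (F has_real_derivative F' x) (at x)"
    and int: "integrable lborel F" "integrable lborel F'"
  shows integral_derivative_atMost: "(LINT x:{..t}|lborel. F' x) = F t"
    and integral_derivative_UNIV: "(\<integral>x. F' x \<partial>lborel) = 0"
proof -
  have si: "set_integrable lborel A F'" if "A \<in> sets borel" for A
    using that int(2) by (intro set_integrable_if_integrable) auto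
  have ftc: "(LINT x:{a..b}|lborel. F' x) = F b - F a" if "a \<le> b" for a b
  proof -
    have "(F' has_integral (F b - F a)) {a..b}"
      using that der by (intro fundamental_theorem_of_calculus)
        (auto simp: has_real_derivative_iff_has_vector_derivative[symmetric]
          intro: has_field_derivative_at_within)
    then show ?thesis
      by (simp add: set_borel_integral_eq_integral(2)[OF si] integral_unique)
  qed
  have atMost: "(LINT x:{..t}|lborel. F' x) = F t" for t
  proof -
    \<comment> \<open>The tail integrals converge, so \<open>F\<close> has a limit at minus
      infinity, and integrability of \<open>F\<close> forces this limit to be 0.\<close>
    have "((\<lambda>a. F t - (LINT x:{a..t}|lborel. F' x)) \<longlongrightarrow> F t - (LINT x:{..t}|lborel. F' x)) at_bot"
      by (intro tendsto_intros tendsto_set_lebesgue_integral_at_bot si) auto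
    moreover have "\<forall>\<^sub>F a in at_bot. F t - (LINT x:{a..t}|lborel. F' x) = F a"
      using eventually_le_at_bot[of t] by eventually_elim (simp add: ftc)
    ultimately have "(F \<longlongrightarrow> F t - (LINT x:{..t}|lborel. F' x)) at_bot"
      by (rule Lim_transform_eventually)
    from integrable_limit_at_bot_zero[OF int(1) this] show ?thesis by simp
  qed
  then show "(LINT x:{..t}|lborel. F' x) = F t" .
  have "((\<lambda>b. F 0 + (LINT x:{0..b}|lborel. F' x)) \<longlongrightarrow> F 0 + (LINT x:{0..}|lborel. F' x)) at_top"
    by (intro tendsto_intros tendsto_set_lebesgue_integral_at_top si) auto
  moreover have "\<forall>\<^sub>F b in at_top. F 0 + (LINT x:{0..b}|lborel. F' x) = F b"
    using eventually_ge_at_top[of 0] by eventually_elim (simp add: ftc)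
  ultimately have "(F \<longlongrightarrow> F 0 + (LINT x:{0..}|lborel. F' x)) at_top"
    by (rule Lim_transform_eventually)
  from integrable_limit_at_top_zero[OF int(1) this]
  have "(LINT x:{0..}|lborel. F' x) = - F 0" by simp
  moreover have "(LINT x:{..0} \<union> {0..}|lborel. F' x)
      = (LINT x:{..0}|lborel. F' x) + (LINT x:{0..}|lborel. F' x)"
    using AE_lborel_singleton[of "0::real"] by (intro set_integral_Un_AE si) auto
  moreover have "{..0} \<union> {0..} = (UNIV :: real set)" by auto
  ultimately show "(\<integral>x. F' x \<partial>lborel) = 0"
    using atMost[of 0] by (simp add: set_lebesgue_integral_def)
qed

lemma bounded_if_integrable_derivative:
  fixes F :: "real \<Rightarrow> real"
  assumes "\<And>x. (F has_real_derivative F' x) (at x)"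
    and "integrable lborel F" "integrable lborel F'"
  shows "\<bar>F t\<bar> \<le> (\<integral>x. \<bar>F' x\<bar> \<partial>lborel)"
proof -
  have "\<bar>F t\<bar> = \<bar>LINT x:{..t}|lborel. F' x\<bar>"
    using integral_derivative_atMost[OF assms] by simp
  also have "\<dots> \<le> (\<integral>x. \<bar>indicator {..t} x *\<^sub>R F' x\<bar> \<partial>lborel)"
    unfolding set_lebesgue_integral_def by (rule integral_abs_bound)
  also have "\<dots> \<le> (\<integral>x. \<bar>F' x\<bar> \<partial>lborel)"
    using assms(3) by (intro integral_mono integrable_abs integrable_mult_indicator)
      (auto simp: abs_mult split: split_indicator)
  finally show ?thesis .
qed

section \<open>Gaussian smoothing\<close>

text \<open>Left unnormalised: a positive constant does not affect signs, and it is divided out in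
  the limit.\<close>

definition gauss :: "real \<Rightarrow> real \<Rightarrow> real" where
  "gauss \<sigma> x = exp (- ((x / \<sigma>)\<^sup>2))"

definition gauss' :: "real \<Rightarrow> real \<Rightarrow> real" where
  "gauss' \<sigma> x = - (2 * x / \<sigma>\<^sup>2) * gauss \<sigma> x"

lemma gauss_pos: "0 < gauss \<sigma> x" and gauss_le_1: "gauss \<sigma> x \<le> 1"
  by (auto simp: gauss_def)

lemma has_derivative_gauss: "(gauss \<sigma> has_real_derivative gauss' \<sigma> x) (at x)"
proof -
  have "((\<lambda>x. exp (- (x * x / (\<sigma> * \<sigma>)))) has_real_derivative gauss' \<sigma> x) (at x)"
    unfolding gauss'_def gauss_def
    by (cases "\<sigma> = 0") (auto intro!: derivative_eq_intros simp: power2_eq_square)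
  then show ?thesis
    by (simp add: gauss_def[abs_def] power2_eq_square)
qed

lemma gauss_measurable [measurable]: "gauss \<sigma> \<in> borel_measurable borel"
  unfolding gauss_def[abs_def] by measurable

lemma gauss'_measurable [measurable]: "gauss' \<sigma> \<in> borel_measurable borel"
  unfolding gauss'_def[abs_def] by measurable

lemma gauss'_bound:
  assumes "0 < \<sigma>"
  shows "\<bar>gauss' \<sigma> x\<bar> \<le> 2 / \<sigma>"
proof -
  define y where "y = \<bar>x\<bar> / \<sigma>"
  have "0 \<le> y" using assms by (simp add: y_def)
  have "2 * y \<le> y\<^sup>2 + 1"
    using zero_le_power2[of "y - 1"] by (simp add: power2_diff)
  then have "y \<le> 1 + y\<^sup>2" using \<open>0 \<le> y\<close> by simp
  also have "\<dots> \<le> exp (y\<^sup>2)" by (rule exp_ge_add_one_self)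
  finally have "y * exp (- (y\<^sup>2)) \<le> exp (y\<^sup>2) * exp (- (y\<^sup>2))"
    by (rule mult_right_mono) simp
  then have "y * exp (- (y\<^sup>2)) \<le> 1"
    by (simp add: exp_add[symmetric])
  then have "2 / \<sigma> * (y * exp (- (y\<^sup>2))) \<le> 2 / \<sigma> * 1"
    using assms by (intro mult_left_mono) auto
  also have "2 / \<sigma> * (y * exp (- (y\<^sup>2))) = \<bar>gauss' \<sigma> x\<bar>"
    using assms by (simp add: gauss'_def gauss_def y_def abs_mult power_divide power2_eq_square)
  finally show ?thesis by simp
qed

definition smooth :: "real \<Rightarrow> (real \<Rightarrow> real) \<Rightarrow> real \<Rightarrow> real" where
  "smooth \<sigma> h z = (\<integral>s. h s * gauss \<sigma> (z - s) \<partial>lborel)"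

lemma integrable_mult_bounded:
  fixes h g :: "real \<Rightarrow> real"
  assumes h: "integrable lborel h" and g[measurable]: "g \<in> borel_measurable borel"
    and b: "\<And>x. \<bar>g x\<bar> \<le> B"
  shows "integrable lborel (\<lambda>s. h s * g s)"
proof (rule Bochner_Integration.integrable_bound)
  show "integrable lborel (\<lambda>s. B * h s)" using h by simp
  show "(\<lambda>s. h s * g s) \<in> borel_measurable lborel"
    using borel_measurable_integrable[OF h] by measurable
  have "0 \<le> B" using b[of 0] by simp
  then show "AE s in lborel. norm (h s * g s) \<le> norm (B * h s)"
    using b by (auto simp: abs_mult mult.commute intro!: mult_right_mono)
qed

lemma integrable_mult_gauss:
  assumes "integrable lborel h"
  shows "integrable lborel (\<lambda>s. h s * gauss \<sigma> (z - s))"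
  by (rule integrable_mult_bounded[OF assms, where B = 1])
     (auto intro: gauss_le_1 simp: gauss_pos less_imp_le)

lemma integrable_mult_gauss':
  assumes "integrable lborel h" "0 < \<sigma>"
  shows "integrable lborel (\<lambda>s. h s * gauss' \<sigma> (z - s))"
  by (rule integrable_mult_bounded[OF assms(1), where B = "2 / \<sigma>"])
     (auto intro: gauss'_bound assms)

text \<open>The derivative falls on the kernel, so integrability of \<open>h\<close> suffices: the
  difference quotients of the Gaussian are bounded by 2 / \<sigma>, which yields a dominating
  function.\<close>

lemma has_derivative_smooth_kernel:
  assumes h: "integrable lborel h" and \<sigma>: "0 < \<sigma>"
  shows "(smooth \<sigma> h has_real_derivative (\<integral>s. h s * gauss' \<sigma> (z - s) \<partial>lborel)) (at z)"
  unfolding has_field_derivative_iff tendsto_at_iff_sequentially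
proof (intro allI impI)
  fix X :: "nat \<Rightarrow> real"
  assume X: "\<forall>i. X i \<in> UNIV - {z}" "X \<longlonglongrightarrow> z"
  let ?q = "\<lambda>i s. (gauss \<sigma> (X i - s) - gauss \<sigma> (z - s)) / (X i - z)"
  have "(\<lambda>i. \<integral>s. h s * ?q i s \<partial>lborel) \<longlonglongrightarrow> (\<integral>s. h s * gauss' \<sigma> (z - s) \<partial>lborel)"
  proof (rule integral_dominated_convergence[where w = "\<lambda>s. 2 / \<sigma> * \<bar>h s\<bar>"])
    note [measurable] = borel_measurable_integrable[OF h]
    show "(\<lambda>s. h s * gauss' \<sigma> (z - s)) \<in> borel_measurable lborel"
      by measurable
    show "(\<lambda>s. h s * ?q i s) \<in> borel_measurable lborel" for i
      by measurable
    show "integrable lborel (\<lambda>s. 2 / \<sigma> * \<bar>h s\<bar>)" using h by simp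
    show "AE s in lborel. (\<lambda>i. h s * ?q i s) \<longlonglongrightarrow> h s * gauss' \<sigma> (z - s)"
    proof (intro AE_I2 tendsto_mult tendsto_const)
      fix s
      have "((\<lambda>y. gauss \<sigma> (y - s)) has_real_derivative gauss' \<sigma> (z - s)) (at z)"
        by (rule DERIV_cong, rule DERIV_chain2[OF has_derivative_gauss])
           (auto intro!: derivative_eq_intros)
      then show "(\<lambda>i. ?q i s) \<longlonglongrightarrow> gauss' \<sigma> (z - s)"
        using X unfolding has_field_derivative_iff tendsto_at_iff_sequentially comp_def by blast
    qed
    show "AE s in lborel. norm (h s * ?q i s) \<le> 2 / \<sigma> * \<bar>h s\<bar>" for i
    proof (intro AE_I2)
      fix s
      have "norm (gauss \<sigma> (X i - s) - gauss \<sigma> (z - s)) \<le> 2 / \<sigma> * norm ((X i - s) - (z - s))"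
        by (rule field_differentiable_bound[of UNIV _ "gauss' \<sigma>"])
           (auto intro: has_derivative_gauss gauss'_bound \<sigma>)
      then have "\<bar>?q i s\<bar> \<le> 2 / \<sigma>"
        using X(1) by (simp add: abs_divide pos_divide_le_eq)
      then show "norm (h s * ?q i s) \<le> 2 / \<sigma> * \<bar>h s\<bar>"
        unfolding real_norm_def abs_mult by (subst mult.commute, intro mult_right_mono) auto
    qed
  qed
  moreover have "(smooth \<sigma> h (X i) - smooth \<sigma> h z) / (X i - z) = (\<integral>s. h s * ?q i s \<partial>lborel)" for i
    unfolding smooth_def
    by (subst Bochner_Integration.integral_diff[symmetric])
       (auto intro: integrable_mult_gauss h simp: right_diff_distrib[symmetric]
         simp flip: Bochner_Integration.integral_divide_zero)
  ultimately show "((\<lambda>y. (smooth \<sigma> h y - smooth \<sigma> h z) / (y - z)) \<circ> X)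
      \<longlonglongrightarrow> (\<integral>s. h s * gauss' \<sigma> (z - s) \<partial>lborel)"
    unfolding comp_def by (simp only:)
qed

text \<open>Integration by parts moves the derivative from the kernel to \<open>h\<close>: the
  product of \<open>h\<close> and the kernel is integrable with integrable derivative, so the
  boundary terms vanish.\<close>

lemma has_derivative_smooth:
  assumes der: "\<And>x. (h has_real_derivative h' x) (at x)"
    and int: "integrable lborel h" "integrable lborel h'" and \<sigma>: "0 < \<sigma>"
  shows "(smooth \<sigma> h has_real_derivative smooth \<sigma> h' z) (at z)"
proof -
  have "(\<integral>s. h' s * gauss \<sigma> (z - s) - h s * gauss' \<sigma> (z - s) \<partial>lborel) = 0"
  proof (rule integral_derivative_UNIV[where F = "\<lambda>s. h s * gauss \<sigma> (z - s)"])
    fix s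
    have "((\<lambda>s. gauss \<sigma> (z - s)) has_real_derivative - gauss' \<sigma> (z - s)) (at s)"
      by (rule DERIV_cong, rule DERIV_chain2[OF has_derivative_gauss])
         (auto intro!: derivative_eq_intros)
    from DERIV_mult[OF der this]
    show "((\<lambda>s. h s * gauss \<sigma> (z - s)) has_real_derivative
        h' s * gauss \<sigma> (z - s) - h s * gauss' \<sigma> (z - s)) (at s)"
      by (simp add: mult_ac)
  qed (intro integrable_mult_gauss integrable_mult_gauss' Bochner_Integration.integrable_diff assms)+
  then have "(\<integral>s. h s * gauss' \<sigma> (z - s) \<partial>lborel) = smooth \<sigma> h' z"
    by (subst (asm) Bochner_Integration.integral_diff)
       (auto simp: smooth_def intro: integrable_mult_gauss integrable_mult_gauss' assms)
  with has_derivative_smooth_kernel[OF int(1) \<sigma>, of z] show ?thesis by simp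
qed

lemma integrable_gauss_1: "integrable lborel (\<lambda>x. exp (- (x\<^sup>2)) :: real)"
  and integral_gauss_1: "0 < (\<integral>x. exp (- (x\<^sup>2)) \<partial>lborel :: real)"
proof -
  have *: "exp (- (x\<^sup>2)) = sqrt pi * normal_density 0 (1 / sqrt 2) x" for x
    by (simp add: normal_density_def power_divide)
  show "integrable lborel (\<lambda>x. exp (- (x\<^sup>2)) :: real)"
    unfolding * by (intro integrable_mult_right) simp
  show "0 < (\<integral>x. exp (- (x\<^sup>2)) \<partial>lborel :: real)"
    unfolding * by simp
qed

text \<open>Substituting s = z - \<sigma> x fixes the Gaussian and moves the width into the argument
  of \<open>h\<close>, so bounded convergence applies; the factor \<open>real (Suc i)\<close>
  compensates the Jacobian \<sigma>.\<close>

lemma smooth_tendsto: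
  assumes cont: "continuous_on UNIV h" and bnd: "\<And>x. \<bar>h x\<bar> \<le> B"
  shows "(\<lambda>i. smooth (1 / real (Suc i)) h z * real (Suc i))
    \<longlonglongrightarrow> h z * (\<integral>x. exp (- (x\<^sup>2)) \<partial>lborel)"
proof -
  define \<sigma> where "\<sigma> i = 1 / real (Suc i)" for i
  have \<sigma>: "0 < \<sigma> i" for i by (simp add: \<sigma>_def)
  have [measurable]: "h \<in> borel_measurable borel"
    using cont by (rule borel_measurable_continuous_onI)
  have "(\<lambda>i. \<integral>x. h (z - \<sigma> i * x) * exp (- (x\<^sup>2)) \<partial>lborel)
      \<longlonglongrightarrow> (\<integral>x. h z * exp (- (x\<^sup>2)) \<partial>lborel)"
  proof (rule integral_dominated_convergence[where w = "\<lambda>x. B * exp (- (x\<^sup>2))"])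
    show "integrable lborel (\<lambda>x. B * exp (- (x\<^sup>2)) :: real)"
      by (intro integrable_mult_right integrable_gauss_1)
    show "AE x in lborel. (\<lambda>i. h (z - \<sigma> i * x) * exp (- (x\<^sup>2))) \<longlonglongrightarrow> h z * exp (- (x\<^sup>2))"
    proof (intro AE_I2 tendsto_mult tendsto_const)
      fix x
      have "\<sigma> \<longlonglongrightarrow> 0"
        unfolding \<sigma>_def using LIMSEQ_Suc[OF lim_1_over_n] by simp
      then have "(\<lambda>i. z - \<sigma> i * x) \<longlonglongrightarrow> z - 0 * x"
        by (intro tendsto_intros)
      then show "(\<lambda>i. h (z - \<sigma> i * x)) \<longlonglongrightarrow> h z"
        using continuous_on_tendsto_compose[OF cont] by simp
    qed
    show "AE x in lborel. norm (h (z - \<sigma> i * x) * exp (- (x\<^sup>2))) \<le> B * exp (- (x\<^sup>2))" for i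
      using bnd by (auto simp: abs_mult)
  qed measurable
  moreover have "smooth (\<sigma> i) h z = \<sigma> i * (\<integral>x. h (z - \<sigma> i * x) * exp (- (x\<^sup>2)) \<partial>lborel)" for i
  proof -
    have "smooth (\<sigma> i) h z = \<bar>- \<sigma> i\<bar> *\<^sub>R
        (\<integral>x. h (z + (- \<sigma> i) * x) * gauss (\<sigma> i) (z - (z + (- \<sigma> i) * x)) \<partial>lborel)"
      unfolding smooth_def by (rule lborel_integral_real_affine) (use \<sigma>[of i] in simp)
    then show ?thesis
      using \<sigma>[of i] by (simp add: gauss_def)
  qed
  then have "smooth (\<sigma> i) h z * real (Suc i) = (\<integral>x. h (z - \<sigma> i * x) * exp (- (x\<^sup>2)) \<partial>lborel)" for i
    by (simp add: \<sigma>_def)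
  ultimately show ?thesis by (simp add: \<sigma>_def)
qed

section \<open>Integrals of determinants\<close>

interpretation lborel_product: product_sigma_finite "\<lambda>_::nat. lborel :: real measure"
  by standard

abbreviation lborel_n :: "nat \<Rightarrow> (nat \<Rightarrow> real) measure" where
  "lborel_n n \<equiv> PiM {..<n} (\<lambda>_. lborel)"

lemma det_of_altdef_cols:
  "det_of n A = (\<Sum>p | p permutes {..<n}. of_int (sign p) * (\<Prod>j<n. A (p j) j))"
  using det_of_altdef[of n "\<lambda>i j. A j i"] det_of_transpose[of n A] by simp

text \<open>Expansion over permutations makes every term a product of functions of one variable, so
  Fubini applies. With indicators for \<open>\<psi>\<close> this integrates the determinant over a
  box.\<close>

lemma
  assumes int: "\<And>i j. i < n \<Longrightarrow> j < n \<Longrightarrow> integrable lborel (\<lambda>x. f i x * \<psi> j x)"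
  shows integrable_prod_det: "integrable (lborel_n n) (\<lambda>s. (\<Prod>j<n. \<psi> j (s j)) * det_of n (\<lambda>i j. f i (s j)))"
    and integral_prod_det: "(\<integral>s. (\<Prod>j<n. \<psi> j (s j)) * det_of n (\<lambda>i j. f i (s j)) \<partial>lborel_n n)
      = det_of n (\<lambda>i j. \<integral>x. f i x * \<psi> j x \<partial>lborel)"
proof -
  let ?P = "{p. p permutes {..<n}}"
  have *: "(\<Prod>j<n. \<psi> j (s j)) * det_of n (\<lambda>i j. f i (s j))
      = (\<Sum>p\<in>?P. of_int (sign p) * (\<Prod>j<n. f (p j) (s j) * \<psi> j (s j)))" for s
    by (subst det_of_scale_cols[symmetric]) (simp add: det_of_altdef_cols mult.commute)
  have lt: "p j < n" if "p \<in> ?P" "j < n" for p j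
    using permutes_in_image[of p "{..<n}" j] that by simp
  have i: "integrable (lborel_n n) (\<lambda>s. of_int (sign p) * (\<Prod>j<n. f (p j) (s j) * \<psi> j (s j)))"
    if "p \<in> ?P" for p
    using lt[OF that] by (intro integrable_mult_right lborel_product.product_integrable_prod int) auto
  show "integrable (lborel_n n) (\<lambda>s. (\<Prod>j<n. \<psi> j (s j)) * det_of n (\<lambda>i j. f i (s j)))"
    unfolding * by (intro Bochner_Integration.integrable_sum i)
  have "(\<integral>s. (\<Prod>j<n. \<psi> j (s j)) * det_of n (\<lambda>i j. f i (s j)) \<partial>lborel_n n)
      = (\<Sum>p\<in>?P. \<integral>s. of_int (sign p) * (\<Prod>j<n. f (p j) (s j) * \<psi> j (s j)) \<partial>lborel_n n)"
    unfolding * by (intro Bochner_Integration.integral_sum i)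
  also have "\<dots> = (\<Sum>p\<in>?P. of_int (sign p) * (\<Prod>j<n. \<integral>x. f (p j) x * \<psi> j x \<partial>lborel))"
  proof (intro sum.cong refl)
    fix p assume p: "p \<in> ?P"
    have "(\<integral>s. (\<Prod>j<n. f (p j) (s j) * \<psi> j (s j)) \<partial>lborel_n n)
        = (\<Prod>j<n. \<integral>x. f (p j) x * \<psi> j x \<partial>lborel)"
      using lt[OF p] by (intro lborel_product.product_integral_prod int) auto
    then show "(\<integral>s. of_int (sign p) * (\<Prod>j<n. f (p j) (s j) * \<psi> j (s j)) \<partial>lborel_n n)
        = of_int (sign p) * (\<Prod>j<n. \<integral>x. f (p j) x * \<psi> j x \<partial>lborel)"
      by simp
  qed
  also have "\<dots> = det_of n (\<lambda>i j. \<integral>x. f i x * \<psi> j x \<partial>lborel)"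
    by (simp add: det_of_altdef_cols)
  finally show "(\<integral>s. (\<Prod>j<n. \<psi> j (s j)) * det_of n (\<lambda>i j. f i (s j)) \<partial>lborel_n n)
      = det_of n (\<lambda>i j. \<integral>x. f i x * \<psi> j x \<partial>lborel)" .
qed

text \<open>Expanding the second determinant, each permutation contributes the same amount: its sign
  occurs once in the expansion and once from permuting the columns of the result.\<close>

lemma
  assumes int: "\<And>i j. i < n \<Longrightarrow> j < n \<Longrightarrow> integrable lborel (\<lambda>x. f i x * g j x)"
  shows integrable_det_mult_det:
      "integrable (lborel_n n) (\<lambda>s. det_of n (\<lambda>i j. f i (s j)) * det_of n (\<lambda>i j. g i (s j)))"
    and Andreief:
      "(\<integral>s. det_of n (\<lambda>i j. f i (s j)) * det_of n (\<lambda>i j. g i (s j)) \<partial>lborel_n n)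
        = fact n * det_of n (\<lambda>i j. \<integral>x. f i x * g j x \<partial>lborel)"
proof -
  let ?P = "{p. p permutes {..<n}}"
  have *: "det_of n (\<lambda>i j. f i (s j)) * det_of n (\<lambda>i j. g i (s j))
      = (\<Sum>p\<in>?P. of_int (sign p) * ((\<Prod>j<n. g (p j) (s j)) * det_of n (\<lambda>i j. f i (s j))))" for s
    by (subst (2) det_of_altdef_cols) (simp add: sum_distrib_left mult_ac)
  have lt: "p j < n" if "p \<in> ?P" "j < n" for p j
    using permutes_in_image[of p "{..<n}" j] that by simp
  have i: "integrable (lborel_n n)
      (\<lambda>s. of_int (sign p) * ((\<Prod>j<n. g (p j) (s j)) * det_of n (\<lambda>i j. f i (s j))))"
    if "p \<in> ?P" for p
    using lt[OF that]
    by (intro integrable_mult_right integrable_prod_det[where \<psi> = "\<lambda>j. g (p j)"] int) auto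
  show "integrable (lborel_n n) (\<lambda>s. det_of n (\<lambda>i j. f i (s j)) * det_of n (\<lambda>i j. g i (s j)))"
    unfolding * by (intro Bochner_Integration.integrable_sum i)
  have "(\<integral>s. det_of n (\<lambda>i j. f i (s j)) * det_of n (\<lambda>i j. g i (s j)) \<partial>lborel_n n)
      = (\<Sum>p\<in>?P. \<integral>s. of_int (sign p) *
          ((\<Prod>j<n. g (p j) (s j)) * det_of n (\<lambda>i j. f i (s j))) \<partial>lborel_n n)"
    unfolding * by (intro Bochner_Integration.integral_sum i)
  also have "\<dots> = (\<Sum>p\<in>?P. det_of n (\<lambda>i j. \<integral>x. f i x * g j x \<partial>lborel))"
  proof (intro sum.cong refl)
    fix p assume p: "p \<in> ?P"
    have "(\<integral>s. (\<Prod>j<n. g (p j) (s j)) * det_of n (\<lambda>i j. f i (s j)) \<partial>lborel_n n)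
        = det_of n (\<lambda>i j. \<integral>x. f i x * g (p j) x \<partial>lborel)"
      using lt[OF p] by (intro integral_prod_det int) auto
    also have "\<dots> = of_int (sign p) * det_of n (\<lambda>i j. \<integral>x. f i x * g j x \<partial>lborel)"
      using p by (intro det_of_permute_cols) auto
    finally show "(\<integral>s. of_int (sign p) * ((\<Prod>j<n. g (p j) (s j)) * det_of n (\<lambda>i j. f i (s j)))
        \<partial>lborel_n n) = det_of n (\<lambda>i j. \<integral>x. f i x * g j x \<partial>lborel)"
      by (simp add: sign_def)
  qed
  also have "\<dots> = fact n * det_of n (\<lambda>i j. \<integral>x. f i x * g j x \<partial>lborel)"
    by (simp add: card_permutations)
  finally show "(\<integral>s. det_of n (\<lambda>i j. f i (s j)) * det_of n (\<lambda>i j. g i (s j)) \<partial>lborel_n n)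
        = fact n * det_of n (\<lambda>i j. \<integral>x. f i x * g j x \<partial>lborel)" .
qed

lemma det_of_integrals_nonneg:
  fixes f :: "nat \<Rightarrow> real \<Rightarrow> real"
  assumes "\<And>i. i < n \<Longrightarrow> integrable lborel (f i)"
    and "\<And>j. j < n \<Longrightarrow> J j \<in> sets borel"
    and "\<And>s. (\<And>j. j < n \<Longrightarrow> s j \<in> J j) \<Longrightarrow> 0 \<le> det_of n (\<lambda>i j. f i (s j))"
  shows "0 \<le> det_of n (\<lambda>i j. LINT x:J j|lborel. f i x)"
proof -
  have "0 \<le> (\<integral>s. (\<Prod>j<n. indicator (J j) (s j)) * det_of n (\<lambda>i j. f i (s j)) \<partial>lborel_n n)"
  proof (intro integral_nonneg_AE AE_I2)
    fix s
    show "0 \<le> (\<Prod>j<n. indicator (J j) (s j)) * det_of n (\<lambda>i j. f i (s j))"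
    proof (cases "\<forall>j<n. s j \<in> J j")
      case True
      then show ?thesis using assms(3)[of s] by simp
    next
      case False
      then have *: "(\<Prod>j<n. indicator (J j) (s j) :: real) = 0"
        by (intro prod_zero) (auto simp: indicator_def)
      show ?thesis unfolding * by simp
    qed
  qed
  also have "\<dots> = det_of n (\<lambda>i j. \<integral>x. f i x * indicator (J j) x \<partial>lborel)"
    using assms(1,2) by (intro integral_prod_det integrable_real_mult_indicator) auto
  finally show ?thesis
    by (simp add: set_lebesgue_integral_def mult.commute)
qed

text \<open>Read backwards, a nonzero determinant of integrals shows that the integrand does not
  vanish almost everywhere on the box.\<close>

lemma det_of_integrals_eq_0:
  fixes f :: "nat \<Rightarrow> real \<Rightarrow> real"
  assumes "\<And>i. i < n \<Longrightarrow> integrable lborel (f i)"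
    and "\<And>j. j < n \<Longrightarrow> J j \<in> sets borel"
    and "AE s in lborel_n n. (\<forall>j<n. s j \<in> J j) \<longrightarrow> det_of n (\<lambda>i j. f i (s j)) = 0"
  shows "det_of n (\<lambda>i j. LINT x:J j|lborel. f i x) = 0"
proof -
  have "(\<integral>s. (\<Prod>j<n. indicator (J j) (s j)) * det_of n (\<lambda>i j. f i (s j)) \<partial>lborel_n n) = 0"
    using assms(3) by (intro integral_eq_zero_AE) (auto split: split_indicator elim!: eventually_mono)
  also have "(\<integral>s. (\<Prod>j<n. indicator (J j) (s j)) * det_of n (\<lambda>i j. f i (s j)) \<partial>lborel_n n)
      = det_of n (\<lambda>i j. \<integral>x. f i x * indicator (J j) x \<partial>lborel)"
    using assms(1,2) by (intro integral_prod_det integrable_real_mult_indicator) auto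
  finally show ?thesis
    by (simp add: set_lebesgue_integral_def mult.commute)
qed

section \<open>Interlacing\<close>

text \<open>Half-open on the right, so that for increasing \<open>b\<close> the \<open>m + 1\<close>
  intervals tile the line and points picked from them are strictly increasing; the first and the
  last interval are unbounded.\<close>

definition interlacing_interval :: "nat \<Rightarrow> (nat \<Rightarrow> real) \<Rightarrow> nat \<Rightarrow> real set" where
  "interlacing_interval m b c = {x. (0 < c \<longrightarrow> b (c - 1) < x) \<and> (c < m \<longrightarrow> x \<le> b c)}"

lemma interlacing_interval_borel [measurable, simp]: "interlacing_interval m b c \<in> sets borel"
  unfolding interlacing_interval_def by measurable

lemma interlacing_strict_mono:
  assumes b: "strict_mono_on {..<m} b"
    and s: "\<And>c. c < Suc m \<Longrightarrow> s c \<in> interlacing_interval m b c"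
  shows "strict_mono_on {..<Suc m} s"
proof (rule strict_mono_onI)
  fix c d assume cd: "c \<in> {..<Suc m}" "d \<in> {..<Suc m}" "c < d"
  have "s c \<le> b c"
    using s[of c] cd by (auto simp: interlacing_interval_def)
  also have "b c \<le> b (d - 1)"
  proof (cases "c = d - 1")
    case False
    then show ?thesis
      using cd by (intro less_imp_le strict_mono_onD[OF b]) auto
  qed simp
  also have "b (d - 1) < s d"
    using s[of d] cd by (auto simp: interlacing_interval_def)
  finally show "s c < s d" .
qed

text \<open>
  The density of the eigenvalues of a principal submatrix is obtained by integrating the density
  of all eigenvalues over the interlacing region. Since the rows are successive derivatives, this
  only removes one row and one column of the determinant.
\<close>

lemma det_of_interlacing:
  assumes der: "\<And>j x. j < m \<Longrightarrow> (v j has_real_derivative - v (Suc j) x) (at x)"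
    and int: "\<And>j. j \<le> m \<Longrightarrow> integrable lborel (v j)"
    and b: "strict_mono_on {..<m} b"
  shows "det_of (Suc m) (\<lambda>j c. LINT x:interlacing_interval m b c|lborel. v j x)
    = (\<integral>x. v 0 x \<partial>lborel) * det_of m (\<lambda>j c. v j (b c))"
proof -
  \<comment> \<open>Cumulative integrals, with the total integral in column \<open>m\<close>.
    Integrals over the tiles are differences of neighbouring columns of \<open>T\<close>.\<close>
  define T where "T j c = (LINT x:(if c < m then {..b c} else UNIV)|lborel. v j x)" for j c
  have si: "set_integrable lborel A (v j)" if "j \<le> m" "A \<in> sets borel" for j A
    using that int by (intro set_integrable_if_integrable) auto
  have T: "(LINT x:interlacing_interval m b c|lborel. v j x)
      = (if c = 0 then T j 0 else T j c - T j (c - 1))" if "j \<le> m" "c \<le> m" for j c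
  proof (cases "c = 0")
    case True
    have "interlacing_interval m b c = (if c < m then {..b c} else UNIV)"
      using True by (auto simp: interlacing_interval_def)
    then show ?thesis using True by (simp add: T_def)
  next
    case False
    have "b (c - 1) < b c" if "c < m"
      using b False that by (auto simp: strict_mono_on_def)
    then have "(if c < m then {..b c} else UNIV) = {..b (c - 1)} \<union> interlacing_interval m b c"
      using False by (auto simp: interlacing_interval_def)
    then have "T j c = (LINT x:{..b (c - 1)}|lborel. v j x)
        + (LINT x:interlacing_interval m b c|lborel. v j x)"
      unfolding T_def using False that(1)
      by (simp add: set_integral_Un[OF _ si si] interlacing_interval_def disjoint_iff)
    moreover have "T j (c - 1) = (LINT x:{..b (c - 1)}|lborel. v j x)"
      using False that(2) by (auto simp: T_def)
    ultimately show ?thesis using False by simp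
  qed
  have "det_of (Suc m) (\<lambda>j c. LINT x:interlacing_interval m b c|lborel. v j x)
      = det_of (Suc m) (\<lambda>j c. if c = 0 then T j 0 else T j c - T j (c - 1))"
    by (intro det_of_cong T) auto
  also have "\<dots> = det_of (Suc m) T"
    using det_of_diff_cols[of "Suc m" T] by simp
  \<comment> \<open>The total integral of a derivative is 0, so only the top entry of the last
    column survives.\<close>
  also have "\<dots> = (-1) ^ m * T 0 m * det_of m (\<lambda>j c. T (Suc j) c)"
  proof (rule det_of_Suc_last_col)
    fix i assume i: "0 < i" "i \<le> m"
    then obtain j where j: "i = Suc j" by (cases i) auto
    have "(\<integral>x. - v i x \<partial>lborel) = 0"
      by (rule integral_derivative_UNIV[where F = "v j"]) (use i j der int in auto)
    then show "T i m = 0" by (simp add: T_def set_lebesgue_integral_def)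
  qed
  also have "det_of m (\<lambda>j c. T (Suc j) c) = det_of m (\<lambda>j c. - 1 * v j (b c))"
  proof (rule det_of_cong)
    fix j c assume jc: "j < m" "c < m"
    have "(LINT x:{..b c}|lborel. - v (Suc j) x) = v j (b c)"
      by (rule integral_derivative_atMost) (use jc der int in auto)
    then show "T (Suc j) c = - 1 * v j (b c)"
      using jc by (simp add: T_def set_lebesgue_integral_def)
  qed
  also have "\<dots> = (-1) ^ m * det_of m (\<lambda>j c. v j (b c))"
    by (subst det_of_scale_rows) simp
  also have "(-1) ^ m * T 0 m * ((-1) ^ m * det_of m (\<lambda>j c. v j (b c)))
      = T 0 m * det_of m (\<lambda>j c. v j (b c))"
    by (simp add: power_mult_distrib[symmetric])
  finally show ?thesis by (simp add: T_def set_lebesgue_integral_def)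
qed

section \<open>Finite differences\<close>

text \<open>The \<open>k\<close>-th power of the shift f(x) -> f(x - t) minus the identity. Because
  the argument is shifted to the left, division by t^k approximates (-d/dx)^k without a
  sign.\<close>

definition finite_difference :: "nat \<Rightarrow> real \<Rightarrow> (real \<Rightarrow> real) \<Rightarrow> real \<Rightarrow> real" where
  "finite_difference k t f x = (\<Sum>l\<le>k. real (k choose l) * (-1) ^ (k - l) * f (x - real l * t))"

lemma finite_difference_Suc:
  "finite_difference (Suc k) t f x = finite_difference k t (\<lambda>x. f (x - t) - f x) x"
  unfolding finite_difference_def
  by (subst Leibniz_Suc[of k "\<lambda>m. (-1) ^ m" "\<lambda>l. f (x - real l * t)"])
     (auto intro!: sum.cong simp: algebra_simps)

text \<open>Each use of the mean value theorem trades one difference for one derivative. One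
  difference is kept, so that \<open>v k\<close> is evaluated but not differentiated.\<close>

lemma finite_difference_mean_value:
  assumes "\<And>j x. j < k \<Longrightarrow> (v j has_real_derivative - v (Suc j) x) (at x)" and "0 < t"
  shows "\<exists>\<xi>\<in>{x - real k * t..x}.
    finite_difference (Suc k) t (v 0) x = t ^ k * (v k (\<xi> - t) - v k \<xi>)"
  using assms(1)
proof (induction k arbitrary: v)
  case 0
  then show ?case by (simp add: finite_difference_def)
next
  case (Suc k)
  \<comment> \<open>Differencing commutes with differentiation, so \<open>u\<close> is again a chain
    of signed derivatives.\<close>
  define u where "u j x = v j (x - t) - v j x" for j x
  have u: "(u j has_real_derivative - u (Suc j) x) (at x)" if "j < Suc k" for j x
  proof -
    have "((\<lambda>x. v j (x - t)) has_real_derivative - v (Suc j) (x - t)) (at x)"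
      by (rule DERIV_cong, rule DERIV_chain2[OF Suc.prems[OF that]])
         (auto intro!: derivative_eq_intros)
    from DERIV_diff[OF this Suc.prems[OF that]] show ?thesis
      by (simp add: u_def[abs_def])
  qed
  obtain \<xi> where \<xi>: "\<xi> \<in> {x - real k * t..x}"
      "finite_difference (Suc k) t (u 0) x = t ^ k * (u k (\<xi> - t) - u k \<xi>)"
    using Suc.IH[of u] u by auto
  obtain \<eta> where \<eta>: "\<xi> - t < \<eta>" "\<eta> < \<xi>"
      "u k \<xi> - u k (\<xi> - t) = (\<xi> - (\<xi> - t)) * (- u (Suc k) \<eta>)"
    using MVT2[of "\<xi> - t" \<xi> "u k" "\<lambda>x. - u (Suc k) x"] u[of k] \<open>0 < t\<close> by auto
  have eq: "u k (\<xi> - t) - u k \<xi> = t * u (Suc k) \<eta>"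
    using \<eta>(3) by (simp add: algebra_simps)
  have "finite_difference (Suc (Suc k)) t (v 0) x = finite_difference (Suc k) t (u 0) x"
    by (simp add: finite_difference_Suc[of "Suc k"] u_def[abs_def])
  also have "\<dots> = t ^ Suc k * (v (Suc k) (\<eta> - t) - v (Suc k) \<eta>)"
    unfolding \<xi>(2) eq by (simp add: u_def)
  finally show ?case
    using \<xi>(1) \<eta>(1,2) \<open>0 < t\<close>
    by (intro bexI[of _ \<eta>]) (auto simp: algebra_simps)
qed

text \<open>As \<open>v k\<close> may be discontinuous, \<open>k - 1\<close> mean value steps are
  taken, and the last difference is estimated through the derivative of the preceding function at
  the single point \<open>x\<close>.\<close>

lemma finite_difference_tendsto:
  assumes der: "\<And>j x. j < k \<Longrightarrow> (v j has_real_derivative - v (Suc j) x) (at x)"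
  shows "((\<lambda>t. finite_difference k t (v 0) x / t ^ k) \<longlongrightarrow> v k x) (at_right 0)"
proof (cases k)
  case 0
  then show ?thesis by (simp add: finite_difference_def)
next
  case (Suc k')
  show ?thesis
  proof (rule tendstoI)
    fix e :: real assume "0 < e"
    \<comment> \<open>Both evaluation points lie within \<open>real k * t\<close> of
      \<open>x\<close>, so the two errors add up to at most half of \<open>e * t\<close>.\<close>
    define \<epsilon> where "\<epsilon> = e / (4 * real k)"
    have \<epsilon>: "0 < \<epsilon>" using \<open>0 < e\<close> Suc by (simp add: \<epsilon>_def)
    have "(v k' has_real_derivative - v k x) (at x)"
      using der[of k' x] Suc by simp
    then have "(v k' has_derivative (\<lambda>h. - v k x * h)) (at x)"
      by (simp only: has_field_derivative_def)
    then obtain \<delta> where "0 < \<delta>" and \<delta>: "\<And>y. \<bar>y - x\<bar> < \<delta> \<Longrightarrow>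
        \<bar>v k' y - v k' x - (- v k x * (y - x))\<bar> \<le> \<epsilon> * \<bar>y - x\<bar>"
      unfolding has_derivative_within_alt using \<epsilon> by (auto simp: real_norm_def)
    have "\<forall>\<^sub>F t in at_right 0. t \<in> {0<..<\<delta> / real k}"
      using \<open>0 < \<delta>\<close> Suc by (intro eventually_at_right_real) auto
    then show "\<forall>\<^sub>F t in at_right 0. dist (finite_difference k t (v 0) x / t ^ k) (v k x) < e"
    proof eventually_elim
      case (elim t)
      then have t: "0 < t" "real k * t < \<delta>" using Suc by (auto simp: field_simps)
      obtain \<xi> where \<xi>: "\<xi> \<in> {x - real k' * t..x}"
        "finite_difference k t (v 0) x = t ^ k' * (v k' (\<xi> - t) - v k' \<xi>)"
        using finite_difference_mean_value[of k' v t x] der t Suc by auto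
      have b: "\<bar>v k' y - v k' x + v k x * (y - x)\<bar> \<le> \<epsilon> * (real k * t)"
        if "y \<in> {x - real k * t..x}" for y
      proof -
        have "\<bar>y - x\<bar> \<le> real k * t" using that by auto
        then have "\<epsilon> * \<bar>y - x\<bar> \<le> \<epsilon> * (real k * t)"
          using \<epsilon> by (intro mult_left_mono) auto
        with \<delta>[of y] \<open>\<bar>y - x\<bar> \<le> real k * t\<close> t show ?thesis by simp
      qed
      have "\<xi> - t \<in> {x - real k * t..x}" "\<xi> \<in> {x - real k * t..x}"
        using \<xi>(1) t Suc by (auto simp: algebra_simps)
      from b[OF this(1)] b[OF this(2)]
      have "\<bar>v k' (\<xi> - t) - v k' \<xi> - v k x * t\<bar> \<le> 2 * (\<epsilon> * (real k * t))"
        by (simp add: algebra_simps abs_le_iff)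
      also have "\<dots> = e / 2 * t"
        using Suc by (simp add: \<epsilon>_def field_simps)
      also have "\<dots> < e * t"
        using t \<open>0 < e\<close> by simp
      finally have "\<bar>(v k' (\<xi> - t) - v k' \<xi> - v k x * t) / t\<bar> < e"
        using t by (simp add: abs_divide pos_divide_less_eq)
      also have "(v k' (\<xi> - t) - v k' \<xi> - v k x * t) / t
          = finite_difference k t (v 0) x / t ^ k - v k x"
        unfolding \<xi>(2) using t Suc by (simp add: field_simps)
      finally show ?case by (simp add: dist_real_def)
    qed
  qed
qed

section \<open>Successive derivatives of an integrable function\<close>

text \<open>A weight with its signed derivatives, \<open>v j\<close> being (-d/dx)^j
  \<open>v 0\<close>. Of the last one, \<open>v (n - 1)\<close>, integrability is recorded.\<close>

locale derivative_table =
  fixes n :: nat and v :: "nat \<Rightarrow> real \<Rightarrow> real"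
  assumes two_le_n: "2 \<le> n"
    and der: "\<And>j x. Suc j < n \<Longrightarrow> (v j has_real_derivative - v (Suc j) x) (at x)"
    and int: "\<And>j. j < n \<Longrightarrow> integrable lborel (v j)"
    and nonneg: "\<And>x. 0 \<le> v 0 x"
    and nonzero: "\<exists>x. v 0 x \<noteq> 0"
begin

lemma continuous: "continuous_on UNIV (v 0)"
  using der[of 0] two_le_n by (intro continuous_at_imp_continuous_on ballI DERIV_isCont) auto

lemma integral_pos: "0 < (\<integral>x. v 0 x \<partial>lborel)"
proof -
  obtain x where x: "v 0 x \<noteq> 0" using nonzero by blast
  have int0: "integrable lborel (v 0)" using int two_le_n by simp
  then have si: "set_integrable lborel {x - 1..x + 1} (v 0)"
    by (intro set_integrable_if_integrable) auto
  have "integral {x - 1..x + 1} (v 0) \<noteq> 0"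
    using integral_eq_0_iff[of "x - 1" "x + 1" "v 0"] x nonneg
      continuous_on_subset[OF continuous, of "{x - 1..x + 1}"] by auto
  moreover have "0 \<le> integral {x - 1..x + 1} (v 0)"
    using nonneg by (intro Henstock_Kurzweil_Integration.integral_nonneg
        set_borel_integral_eq_integral(1)[OF si]) auto
  ultimately have "0 < (LINT x:{x - 1..x + 1}|lborel. v 0 x)"
    by (simp add: set_borel_integral_eq_integral(2)[OF si])
  also have "\<dots> \<le> (\<integral>x. v 0 x \<partial>lborel)"
    unfolding set_lebesgue_integral_def
    using int0 nonneg si[unfolded set_integrable_def]
    by (intro integral_mono) (auto split: split_indicator)
  finally show ?thesis .
qed

lemma det_interlacing:
  assumes "m < n" "strict_mono_on {..<m} b"
  shows "det_of (Suc m) (\<lambda>j c. LINT x:interlacing_interval m b c|lborel. v j x)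
    = (\<integral>x. v 0 x \<partial>lborel) * det_of m (\<lambda>j c. v j (b c))"
  by (rule det_of_interlacing) (use assms der int in auto)

text \<open>If the determinant of order m + 1 vanished at all increasing points, integrating it over
  interlacing regions would annihilate the determinant of order m as well, because the total mass of
  \<open>v 0\<close> is positive.\<close>

lemma ex_det_nonzero:
  "m \<le> n \<Longrightarrow> \<exists>b. strict_mono_on {..<m} b \<and> det_of m (\<lambda>j c. v j (b c)) \<noteq> 0"
proof (induction m)
  case (Suc m)
  then obtain b where b: "strict_mono_on {..<m} b" "det_of m (\<lambda>j c. v j (b c)) \<noteq> 0"
    by auto
  show ?case
  proof (rule ccontr)
    assume neg: "\<not> ?case"
    have "det_of (Suc m) (\<lambda>j c. LINT x:interlacing_interval m b c|lborel. v j x) = 0"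
    proof (rule det_of_integrals_eq_0)
      show "AE s in lborel_n (Suc m). (\<forall>j<Suc m. s j \<in> interlacing_interval m b j) \<longrightarrow>
          det_of (Suc m) (\<lambda>i j. v i (s j)) = 0"
        using neg interlacing_strict_mono[OF b(1)] by (intro AE_I2) blast
    qed (use Suc.prems int in auto)
    then show False
      using b integral_pos Suc.prems by (simp add: det_interlacing)
  qed
qed (auto simp: strict_mono_on_def)

text \<open>The form of nonvanishing that is insensitive to null sets. The interlacing intervals of
  a good configuration of order m - 1 serve as the box.\<close>

lemma ex_det_integrals_nonzero:
  assumes "0 < m" "m \<le> n"
  shows "\<exists>J. (\<forall>j. J j \<in> sets borel) \<and> det_of m (\<lambda>j c. LINT x:J c|lborel. v j x) \<noteq> 0"
proof -
  from assms obtain m' where m: "m = Suc m'" by (cases m) auto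
  then obtain b where "strict_mono_on {..<m'} b" "det_of m' (\<lambda>j c. v j (b c)) \<noteq> 0"
    using ex_det_nonzero[of m'] assms by auto
  then show ?thesis
    using integral_pos assms det_interlacing[of m' b]
    by (intro exI[of _ "interlacing_interval m' b"]) (auto simp: m)
qed

text \<open>On increasing points the Vandermonde factor of the density is positive and can be left
  out.\<close>

definition dets_nonneg :: "nat \<Rightarrow> bool" where
  "dets_nonneg m \<longleftrightarrow> (\<forall>s. strict_mono_on {..<m} s \<longrightarrow> 0 \<le> det_of m (\<lambda>j c. v j (s c)))"

lemma dets_nonneg_Suc:
  assumes "dets_nonneg (Suc m)" "m < n"
  shows "dets_nonneg m"
  unfolding dets_nonneg_def
proof (intro allI impI)
  fix b :: "nat \<Rightarrow> real" assume b: "strict_mono_on {..<m} b"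
  have "0 \<le> det_of (Suc m) (\<lambda>j c. LINT x:interlacing_interval m b c|lborel. v j x)"
  proof (rule det_of_integrals_nonneg)
    fix s assume "\<And>j. j < Suc m \<Longrightarrow> s j \<in> interlacing_interval m b j"
    then have "strict_mono_on {..<Suc m} s" by (rule interlacing_strict_mono[OF b])
    with assms(1) show "0 \<le> det_of (Suc m) (\<lambda>i j. v i (s j))"
      by (simp add: dets_nonneg_def)
  qed (use assms int in auto)
  then show "0 \<le> det_of m (\<lambda>j c. v j (b c))"
    using integral_pos by (simp add: det_interlacing[OF assms(2) b] zero_le_mult_iff)
qed

lemma dets_nonneg_mono:
  assumes "dets_nonneg n" "m \<le> n"
  shows "dets_nonneg m"
  using assms(2,1) by (induction rule: inc_induct) (auto intro: dets_nonneg_Suc)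

text \<open>Smoothing makes the determinants strictly positive, as required for dividing by them.\<close>

lemma det_smooth_pos:
  assumes nn: "dets_nonneg m" and m: "0 < m" "m \<le> n" and \<sigma>: "0 < \<sigma>"
    and a: "strict_mono_on {..<m} a"
  shows "0 < det_of m (\<lambda>k c. smooth \<sigma> (v k) (a c))"
proof -
  let ?V = "\<lambda>s. det_of m (\<lambda>i j. v i (s j))"
  let ?G = "\<lambda>s. det_of m (\<lambda>i j. gauss \<sigma> (a i - s j))"
  have ii: "integrable lborel (\<lambda>x. v i x * gauss \<sigma> (a j - x))" if "i < m" for i j
    using that m int by (intro integrable_mult_gauss) auto
  have G: "0 < ?G s" if "strict_mono_on {..<m} s" for s
    using det_of_Gauss_pos[OF a that \<sigma>] by (simp add: gauss_def)
  have VG: "0 \<le> ?V s * ?G s" for s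
  proof -
    have "0 \<le> 1 * (?V s * ?G s)"
      by (rule det_prod_nonneg_if_sorted) (use nn G in \<open>auto simp: dets_nonneg_def less_imp_le\<close>)
    then show ?thesis by simp
  qed
  \<comment> \<open>At distinct points the Gaussian determinant is nonzero, up to sign by sorting;
    at coinciding points the other determinant is 0 anyway.\<close>
  have V0: "?V s = 0" if "?V s * ?G s = 0" for s
  proof (cases "inj_on s {..<m}")
    case True
    then obtain p where p: "p permutes {..<m}" "strict_mono_on {..<m} (\<lambda>j. s (p j))"
      by (rule sorting_permutation)
    have "?G s \<noteq> 0"
      using G[OF p(2)] det_of_permute_cols[OF p(1), of "\<lambda>i j. gauss \<sigma> (a i - s j)"] by auto
    with that show ?thesis by simp
  qed (simp add: det_of_not_inj)
  have int_VG: "integrable (lborel_n m) (\<lambda>s. ?V s * ?G s)"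
    by (rule integrable_det_mult_det[where g = "\<lambda>i x. gauss \<sigma> (a i - x)"]) (rule ii)
  have eq: "(\<integral>s. ?V s * ?G s \<partial>lborel_n m) = fact m * det_of m (\<lambda>k c. smooth \<sigma> (v k) (a c))"
    unfolding smooth_def
    by (rule Andreief[where g = "\<lambda>i x. gauss \<sigma> (a i - x)"]) (rule ii)
  have "0 \<le> (\<integral>s. ?V s * ?G s \<partial>lborel_n m)"
    using VG by (intro integral_nonneg_AE AE_I2)
  moreover have "(\<integral>s. ?V s * ?G s \<partial>lborel_n m) \<noteq> 0"
  proof
    assume "(\<integral>s. ?V s * ?G s \<partial>lborel_n m) = 0"
    then have "AE s in lborel_n m. ?V s * ?G s = 0"
      using integral_nonneg_eq_0_iff_AE[OF int_VG] VG by simp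
    then have ae: "AE s in lborel_n m. ?V s = 0"
      by eventually_elim (rule V0)
    obtain J where J: "\<And>j. J j \<in> sets borel" "det_of m (\<lambda>j c. LINT x:J c|lborel. v j x) \<noteq> 0"
      using ex_det_integrals_nonzero[OF m] by blast
    have "det_of m (\<lambda>j c. LINT x:J c|lborel. v j x) = 0"
      by (rule det_of_integrals_eq_0) (use J m int ae in auto)
    with J show False by simp
  qed
  ultimately have "0 < fact m * det_of m (\<lambda>k c. smooth \<sigma> (v k) (a c))"
    unfolding eq by (metis order_le_less)
  then show ?thesis by (simp add: zero_less_mult_iff)
qed

lemma smooth_uminus: "smooth \<sigma> (\<lambda>x. - h x) z = - smooth \<sigma> h z"
  by (simp add: smooth_def)

text \<open>Smoothing commutes with differentiation, so the Wronskians at \<open>t\<close> are the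
  smoothed determinants at the points \<open>x i - t\<close>, which increase with \<open>i\<close>.
  All leading orders occur, hence the descent to smaller orders.\<close>

lemma det_smooth_shifts_pos:
  assumes nn: "dets_nonneg n" and m: "m \<le> n" and \<sigma>: "0 < \<sigma>"
    and x: "strict_mono_on {..<m} x" and y: "strict_mono_on {..<m} y"
  shows "0 < det_of m (\<lambda>i j. smooth \<sigma> (v 0) (x i - y j))"
proof (rule det_of_pos_if_Wronskians_pos[where U = "\<lambda>i k t. smooth \<sigma> (v k) (x i - t)"])
  fix i k t assume "Suc k < m"
  then have "(smooth \<sigma> (v k) has_real_derivative smooth \<sigma> (\<lambda>x. - v (Suc k) x) (x i - t)) (at (x i - t))"
    using m der int \<sigma> by (intro has_derivative_smooth) auto
  then show "((\<lambda>t. smooth \<sigma> (v k) (x i - t)) has_real_derivative smooth \<sigma> (v (Suc k)) (x i - t)) (at t)"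
    unfolding smooth_uminus
    by (rule DERIV_cong[OF DERIV_chain2]) (auto intro!: derivative_eq_intros)
next
  fix m' t assume m': "0 < m'" "m' \<le> m"
  have "0 < det_of m' (\<lambda>k i. smooth \<sigma> (v k) (x i - t))"
    by (rule det_smooth_pos)
       (use m' m \<sigma> x nn in \<open>auto intro: dets_nonneg_mono simp: strict_mono_on_def\<close>)
  then show "0 < det_of m' (\<lambda>i k. smooth \<sigma> (v k) (x i - t))"
    using det_of_transpose[of m' "\<lambda>k i. smooth \<sigma> (v k) (x i - t)"] by simp
qed (rule y)

lemma det_shifts_nonneg:
  assumes nn: "dets_nonneg n" and m: "m \<le> n"
    and x: "strict_mono_on {..<m} x" and y: "strict_mono_on {..<m} y"
  shows "0 \<le> det_of m (\<lambda>i j. v 0 (x i - y j))"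
proof -
  define c :: real where "c = (\<integral>x. exp (- (x\<^sup>2)) \<partial>lborel)"
  have c: "0 < c" unfolding c_def by (rule integral_gauss_1)
  have "0 \<le> det_of m (\<lambda>i j. v 0 (x i - y j) * c)"
  proof (rule tendsto_lowerbound[OF tendsto_det_of])
    fix i j
    \<comment> \<open>Boundedness of the weight, required for the limit, comes from its integrable
      first derivative; \<open>n\<close> being at least 2 provides that derivative.\<close>
    have "\<bar>v 0 z\<bar> \<le> (\<integral>x. \<bar>- v 1 x\<bar> \<partial>lborel)" for z
      using two_le_n der[of 0] int by (intro bounded_if_integrable_derivative) auto
    then show "(\<lambda>k. smooth (1 / real (Suc k)) (v 0) (x i - y j) * real (Suc k))
        \<longlonglongrightarrow> v 0 (x i - y j) * c"
      unfolding c_def by (rule smooth_tendsto[OF continuous])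
  next
    have "0 \<le> (\<Prod>i<m. real (Suc k)) * det_of m (\<lambda>i j. smooth (1 / real (Suc k)) (v 0) (x i - y j))" for k
      using det_smooth_shifts_pos[OF nn m _ x y, of "1 / real (Suc k)"]
      by (intro mult_nonneg_nonneg prod_nonneg) (auto intro: less_imp_le)
    then show "\<forall>\<^sub>F k in sequentially.
        0 \<le> det_of m (\<lambda>i j. smooth (1 / real (Suc k)) (v 0) (x i - y j) * real (Suc k))"
      by (subst mult.commute, subst det_of_scale_rows) (intro always_eventually allI)
  qed auto
  also have "\<dots> = c ^ m * det_of m (\<lambda>i j. v 0 (x i - y j))"
    by (subst mult.commute, subst det_of_scale_rows) simp
  finally show ?thesis
    using zero_less_power[OF c, of m] by (simp only: zero_le_mult_iff) linarith
qed

section \<open>The Polya frequency property and the signs of the determinants\<close>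

lemma polya_frequency_if_dets_nonneg:
  assumes "dets_nonneg n"
  shows "polya_frequency_function n (v 0)"
  unfolding polya_frequency_function_def
proof (intro conjI ballI allI)
  show "v 0 \<in> borel_measurable borel"
    by (rule borel_measurable_continuous_onI[OF continuous])
  fix m x y assume m: "m \<in> {1..n}"
  \<comment> \<open>The two families of points are freed from sorting one after the other: here
    \<open>y\<close>, below \<open>x\<close> with the other Vandermonde factor as a
    constant.\<close>
  have 1: "0 \<le> vandermonde m y * (1 * det_of m (\<lambda>i j. v 0 (x i - y j)))"
    if "strict_mono_on {..<m} x" for x y
    using det_shifts_nonneg[OF assms _ that] m
      vandermonde_det_nonneg_iff[of m 1 "\<lambda>i t. v 0 (x i - t)"] by simp
  have tr: "det_of m (\<lambda>j i. v 0 (x i - y j)) = det_of m (\<lambda>i j. v 0 (x i - y j))" for x y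
    by (rule det_of_transpose)
  have "0 \<le> vandermonde m x * (vandermonde m y * det_of m (\<lambda>j i. v 0 (x i - y j)))"
    using vandermonde_det_nonneg_iff[of m "vandermonde m y" "\<lambda>j t. v 0 (t - y j)"] 1[of _ y]
    by (simp add: tr)
  then show "0 \<le> vandermonde m x * vandermonde m y * det_of m (\<lambda>b c. v 0 (x b - y c))"
    by (simp add: tr mult.assoc)
qed

lemma dets_nonneg_if_polya_frequency:
  assumes pf: "polya_frequency_function n (v 0)"
  shows "dets_nonneg n"
  unfolding dets_nonneg_def
proof (intro allI impI)
  fix a :: "nat \<Rightarrow> real" assume a: "strict_mono_on {..<n} a"
  show "0 \<le> det_of n (\<lambda>k b. v k (a b))"
  proof (rule tendsto_lowerbound[OF tendsto_det_of])
    show "((\<lambda>t. finite_difference k t (v 0) (a b) / t ^ k) \<longlongrightarrow> v k (a b)) (at_right 0)"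
      if "k < n" for k b
      using that der by (intro finite_difference_tendsto) auto
    have "\<forall>\<^sub>F t in at_right (0::real). 0 < t"
      by (simp add: eventually_at_right_less)
    then show "\<forall>\<^sub>F t in at_right 0. 0 \<le> det_of n (\<lambda>k b. finite_difference k t (v 0) (a b) / t ^ k)"
    proof eventually_elim
      case (elim t)
      \<comment> \<open>Equally spaced points collapsing to 0. Binomial combinations of the
        translates are finite differences, and the diagonal coefficients \<open>1 / t ^ k\<close>
        are positive, so the sign is kept.\<close>
      define y where "y c = real c * t" for c
      have "0 < vandermonde n a * vandermonde n y"
        using elim by (intro mult_pos_pos vandermonde_pos a) (auto simp: y_def strict_mono_on_def)
      moreover have "0 \<le> vandermonde n a * vandermonde n y * det_of n (\<lambda>b c. v 0 (a b - y c))"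
        using pf two_le_n by (auto simp: polya_frequency_function_def)
      ultimately have "0 \<le> det_of n (\<lambda>b c. v 0 (a b - y c))"
        by (simp add: zero_le_mult_iff)
      then have "0 \<le> (\<Prod>k<n. 1 / t ^ k) * det_of n (\<lambda>c b. v 0 (a b - y c))"
        using elim det_of_transpose[of n "\<lambda>b c. v 0 (a b - y c)"]
        by (intro mult_nonneg_nonneg prod_nonneg) auto
      also have "\<dots> = det_of n (\<lambda>k b. \<Sum>l\<le>k. (real (k choose l) * (-1) ^ (k - l) / t ^ k) * v 0 (a b - y l))"
        by (subst det_of_lower_comb) simp
      also have "\<dots> = det_of n (\<lambda>k b. finite_difference k t (v 0) (a b) / t ^ k)"
        by (simp add: finite_difference_def y_def sum_divide_distrib)
      finally show ?case .
    qed
  qed (simp add: trivial_limit_at_right_real)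
qed

end

section \<open>Change of variables\<close>

lemma
  fixes f g g' :: "real \<Rightarrow> real"
  assumes der: "\<And>u. (g has_real_derivative g' u) (at u)" and pos: "\<And>u. 0 < g' u"
    and J: "J \<in> sets borel" and gJ: "g ` J \<in> sets borel"
    and f: "set_integrable lborel (g ` J) f"
    and meas [measurable]: "(\<lambda>u. f (g u) * g' u) \<in> borel_measurable borel"
  shows set_integrable_substitution: "set_integrable lborel J (\<lambda>u. f (g u) * g' u)"
    and set_integral_substitution: "(LINT x:g ` J|lborel. f x) = (LINT u:J|lborel. f (g u) * g' u)"
proof -
  have "strict_mono g"
    using DERIV_pos_imp_increasing[of _ _ g] der pos unfolding strict_mono_def by blast
  then have inj: "inj_on g J"
    by (simp add: strict_mono_imp_inj_on inj_on_subset[OF _ subset_UNIV])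
  have "f absolutely_integrable_on (g ` J)"
    using f borel_measurable_integrable[OF f[unfolded set_integrable_def]]
    by (simp add: set_integrable_def integrable_completion)
  then have "(\<lambda>u. \<bar>g' u\<bar> * f (g u)) absolutely_integrable_on J \<and>
      integral J (\<lambda>u. \<bar>g' u\<bar> * f (g u)) = integral (g ` J) f"
    using has_absolute_integral_change_of_variables_1'[of J g g' f "integral (g ` J) f"]
      J inj has_field_derivative_at_within[OF der] by auto
  moreover have "(\<lambda>u. \<bar>g' u\<bar> * f (g u)) = (\<lambda>u. f (g u) * g' u)"
    using pos by (auto simp: abs_of_pos)
  ultimately have *: "set_integrable lebesgue J (\<lambda>u. f (g u) * g' u)"
      "integral J (\<lambda>u. f (g u) * g' u) = integral (g ` J) f"
    by auto
  \<comment> \<open>The substitution theorem yields integrability for the completed measure; Borel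
    measurability of the integrand brings it back to \<open>lborel\<close>.\<close>
  show si: "set_integrable lborel J (\<lambda>u. f (g u) * g' u)"
    using *(1) J unfolding set_integrable_def
    by (subst (asm) integrable_completion) auto
  show "(LINT x:g ` J|lborel. f x) = (LINT u:J|lborel. f (g u) * g' u)"
    by (simp add: set_borel_integral_eq_integral(2)[OF f] set_borel_integral_eq_integral(2)[OF si] *(2))
qed

section \<open>Polya ensembles and Polya frequency functions\<close>

lemma vandermonde_eq_0_imp_not_inj: "vandermonde n a = 0 \<Longrightarrow> \<not> inj_on a {..<n}"
  unfolding vandermonde_def inj_on_def by fastforce

text \<open>
  Both cases are instances of the following: take \<open>e = id\<close> and \<open>lam = 0\<close> for \<open>H\<^sub>2\<close>, and
  \<open>e = exp\<close> and \<open>lam = 1\<close> for \<open>G\<close>.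
\<close>

lemma polya_ensemble_iff_polya_frequency:
  fixes e e' l :: "real \<Rightarrow> real" and w :: "nat \<Rightarrow> real \<Rightarrow> real"
  assumes n: "2 \<le> n"
    and e: "\<And>u. (e has_real_derivative e' u) (at u)" "\<And>u. 0 < e' u"
    and [measurable]: "e' \<in> borel_measurable borel"
    and l: "\<And>u. l (e u) = u" and [measurable]: "l \<in> borel_measurable borel"
    and N: "N = range e" and N_borel [measurable]: "N \<in> sets borel"
    and der: "\<And>j u. Suc j < n \<Longrightarrow> ((\<lambda>u. w j (e u) * e' u) has_real_derivative
      (lam * (w j (e u) * e' u) - w (Suc j) (e u) * e' u)) (at u)"
    and moments: "\<And>j k. j < n \<Longrightarrow> k < n \<Longrightarrow> set_integrable lborel N (\<lambda>x. x ^ k * w j x)"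
    and nonneg: "\<And>x. x \<in> N \<Longrightarrow> 0 \<le> w 0 x" and nonzero: "\<exists>x\<in>N. w 0 x \<noteq> 0"
  shows "(\<exists>C>0. probability_density_on n N (ensemble_density n w C))
    \<longleftrightarrow> polya_frequency_function n (\<lambda>u. w 0 (e u) * e' u)"
proof -
  define v where "v j u = w j (e u) * e' u" for j u
  \<comment> \<open>\<open>v j\<close> is (lam - d/du)^j \<open>v 0\<close>. Writing -d/du as (lam -
    d/du) - lam, the binomial theorem expresses the pure derivatives \<open>tv\<close> through
    \<open>v\<close> with a unit triangular matrix.\<close>
  define L where "L j k = real (j choose k) * (- lam) ^ (j - k)" for j k
  define tv where "tv j u = (\<Sum>k\<le>j. L j k * v k u)" for j u
  \<comment> \<open>Values of the weights outside \<open>N\<close> are arbitrary; cutting them off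
    permits integration over the whole space.\<close>
  define wN where "wN j x = indicator N x * w j x" for j x
  have eN: "e u \<in> N" for u by (simp add: N)
  have mono: "e x < e y" if "x < y" for x y
    using DERIV_pos_imp_increasing[OF that] e by blast
  have [measurable]: "e \<in> borel_measurable borel"
    using e(1) by (intro borel_measurable_continuous_onI continuous_at_imp_continuous_on ballI DERIV_isCont)
  have int_w: "set_integrable lborel N (w j)" if "j < n" for j
    using moments[of j 0] that n by simp
  have [measurable]: "wN j \<in> borel_measurable borel" if "j < n" for j
    using borel_measurable_integrable[OF int_w[OF that, unfolded set_integrable_def]]
    by (simp add: wN_def[abs_def])
  have meas_v: "(\<lambda>u. w j (e u) * e' u) \<in> borel_measurable borel" if "j < n" for j
  proof -
    have "(\<lambda>u. wN j (e u) * e' u) \<in> borel_measurable borel"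
      using that by measurable
    then show ?thesis by (simp add: wN_def eN)
  qed
  \<comment> \<open>The left inverse \<open>l\<close> turns the image into a preimage, which makes
    it a Borel set.\<close>
  have image: "e ` J = N \<inter> l -` J" for J
    by (auto simp: N l image_iff)
  have eJ: "e ` J \<in> sets borel" if [measurable]: "J \<in> sets borel" for J
    unfolding image using measurable_sets[of l borel borel J] that by auto
  have int_wJ: "set_integrable lborel (e ` J) (w j)" if "J \<in> sets borel" "j < n" for J j
    by (rule set_integrable_subset[OF int_w[OF that(2)]]) (use eJ[OF that(1)] eN in auto)
  have subst: "(LINT x:e ` J|lborel. w j x) = (LINT u:J|lborel. v j u)" if "J \<in> sets borel" "j < n" for J j
    unfolding v_def by (rule set_integral_substitution) (use that e eJ int_wJ meas_v in auto)
  have int_v: "integrable lborel (v j)" if "j < n" for j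
    using set_integrable_substitution[OF e, of UNIV "w j"] int_w[OF that] meas_v[OF that] N N_borel
    by (simp add: v_def[abs_def] set_integrable_def)
  have "v 0 = tv 0"
    by (auto simp: tv_def L_def)
  interpret derivative_table n tv
  proof
    fix j x assume j: "Suc j < n"
    have "((\<lambda>u. \<Sum>k\<le>j. L j k * v k u) has_real_derivative
        (\<Sum>k\<le>j. L j k * (lam * v k x - v (Suc k) x))) (at x)"
      using j der by (intro DERIV_sum DERIV_cmult) (auto simp: v_def[abs_def])
    moreover have "tv (Suc j) x = (\<Sum>k\<le>j. L j k * (v (Suc k) x - lam * v k x))"
      unfolding tv_def L_def
      by (subst Leibniz_Suc[of j "\<lambda>m. (- lam) ^ m" "\<lambda>k. v k x"])
         (auto intro!: sum.cong simp: algebra_simps)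
    ultimately show "(tv j has_real_derivative - tv (Suc j) x) (at x)"
      by (simp add: tv_def[abs_def] sum_negf[symmetric] algebra_simps)
  next
    fix j assume "j < n"
    then show "integrable lborel (tv j)"
      unfolding tv_def[abs_def] using int_v
      by (intro Bochner_Integration.integrable_sum integrable_mult_right) auto
  next
    show "0 \<le> tv 0 x" for x
      unfolding \<open>v 0 = tv 0\<close>[symmetric] using nonneg[OF eN] e(2) by (simp add: v_def less_imp_le)
    from nonzero obtain u where "w 0 (e u) \<noteq> 0" by (auto simp: N)
    then show "\<exists>x. tv 0 x \<noteq> 0"
      unfolding \<open>v 0 = tv 0\<close>[symmetric] using e(2)[of u] by (auto simp: v_def intro!: exI[of _ u])
  qed (rule n)
  have det_tv: "det_of n (\<lambda>j c. tv j (s c)) = (\<Prod>c<n. e' (s c)) * det_of n (\<lambda>j c. w j (e (s c)))" for s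
    unfolding tv_def by (subst det_of_lower_comb)
      (simp add: L_def v_def det_of_scale_cols[symmetric] mult.commute)
  have e'_prod: "0 < (\<Prod>c<n. e' (s c))" for s
    using e(2) by (intro prod_pos) auto
  have vand_e: "0 < vandermonde n (\<lambda>c. e (s c))" if "strict_mono_on {..<n} s" for s
    using that mono by (intro vandermonde_pos) (auto simp: strict_mono_on_def)

  have pf_iff: "polya_frequency_function n (\<lambda>u. w 0 (e u) * e' u) \<longleftrightarrow> dets_nonneg n"
    using polya_frequency_if_dets_nonneg dets_nonneg_if_polya_frequency
    unfolding \<open>v 0 = tv 0\<close>[symmetric] by (auto simp: v_def[abs_def])

  have "dets_nonneg n" if "0 < C" "probability_density_on n N (ensemble_density n w C)" for C
    unfolding dets_nonneg_def
  proof (intro allI impI)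
    fix s :: "nat \<Rightarrow> real" assume s: "strict_mono_on {..<n} s"
    define a where "a = restrict (\<lambda>c. e (s c)) {..<n}"
    have "a \<in> {..<n} \<rightarrow>\<^sub>E N" by (auto simp: a_def eN)
    then have "0 \<le> C * vandermonde n a * det_of n (\<lambda>b c. w b (a c))"
      using that(2) by (simp add: probability_density_on_def ensemble_density_def)
    moreover have "vandermonde n a = vandermonde n (\<lambda>c. e (s c))"
      unfolding vandermonde_def by (intro prod.cong) (auto simp: a_def)
    moreover have "det_of n (\<lambda>b c. w b (a c)) = det_of n (\<lambda>b c. w b (e (s c)))"
      by (intro det_of_cong) (auto simp: a_def)
    ultimately have "0 \<le> det_of n (\<lambda>b c. w b (e (s c)))"
      using mult_pos_pos[OF that(1) vand_e[OF s]] by (metis zero_le_mult_iff not_le)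
    then show "0 \<le> det_of n (\<lambda>j c. tv j (s c))"
      using e'_prod[of s] by (simp add: det_tv)
  qed
  moreover have "\<exists>C>0. probability_density_on n N (ensemble_density n w C)" if nn: "dets_nonneg n"
  proof -
    \<comment> \<open>The unnormalised density, extended by 0 to the whole space, written as a
      product of two determinants so that the moments give its integrability.\<close>
    define q where "q a = det_of n (\<lambda>i j. wN i (a j)) * det_of n (\<lambda>i j. a j ^ i)" for a
    define p where "p a = vandermonde n a * det_of n (\<lambda>b c. w b (a c))" for a
    have qp: "q a = p a" if "\<And>c. c < n \<Longrightarrow> a c \<in> N" for a
    proof -
      have "det_of n (\<lambda>i j. wN i (a j)) = det_of n (\<lambda>b c. w b (a c))"
        using that by (intro det_of_cong) (auto simp: wN_def)
      then show ?thesis by (simp add: p_def q_def vandermonde_eq_det mult.commute)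
    qed
    have q0: "q a = 0" if "c < n" "a c \<notin> N" for a c
    proof -
      have "det_of n (\<lambda>i j. wN i (a j)) = det_of n (\<lambda>i j. indicator N (a j) * w i (a j))"
        by (simp add: wN_def)
      also have "\<dots> = (\<Prod>j<n. indicator N (a j)) * det_of n (\<lambda>i j. w i (a j))"
        by (rule det_of_scale_cols)
      also have "(\<Prod>j<n. indicator N (a j) :: real) = 0"
        using that by (intro prod_zero) (auto simp: indicator_def)
      finally show ?thesis by (simp add: q_def)
    qed
    have p_nonneg: "0 \<le> p a" if a: "\<And>c. c < n \<Longrightarrow> a c \<in> N" for a
    proof -
      define s where "s c = l (a c)" for c
      have es: "e (s c) = a c" if "c < n" for c
        using a[OF that] l by (auto simp: s_def N)
      have "0 \<le> 1 * (det_of n (\<lambda>i j. w i (e (s j))) * det_of n (\<lambda>i j. e (s j) ^ i))"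
      proof (rule det_prod_nonneg_if_sorted[where s = s and f = "\<lambda>i x. w i (e x)" and g = "\<lambda>i x. e x ^ i"])
        fix s :: "nat \<Rightarrow> real" assume s: "strict_mono_on {..<n} s"
        then have "0 \<le> (\<Prod>c<n. e' (s c)) * det_of n (\<lambda>j c. w j (e (s c)))"
          using nn by (simp add: dets_nonneg_def det_tv)
        then have "0 \<le> det_of n (\<lambda>j c. w j (e (s c)))"
          using e'_prod[of s] by (metis zero_le_mult_iff not_le)
        then show "0 \<le> 1 * (det_of n (\<lambda>i j. w i (e (s j))) * det_of n (\<lambda>i j. e (s j) ^ i))"
          using vand_e[OF s] by (simp add: vandermonde_eq_det)
      qed
      also have "\<dots> = p a"
      proof -
        have "det_of n (\<lambda>i j. w i (e (s j))) = det_of n (\<lambda>i j. w i (a j))"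
          "det_of n (\<lambda>i j. e (s j) ^ i) = det_of n (\<lambda>i j. a j ^ i)"
          by (auto intro!: det_of_cong simp: es)
        then show ?thesis by (simp add: p_def vandermonde_eq_det)
      qed
      finally show ?thesis .
    qed
    have q_nonneg: "0 \<le> q a" for a
      using qp[of a] q0[of _ a] p_nonneg[of a] by (cases "\<forall>c<n. a c \<in> N") auto
    have int_q: "integrable (lborel_n n) q"
      unfolding q_def
    proof (rule integrable_det_mult_det[where g = "\<lambda>i x. x ^ i"])
      fix i j assume "i < n" "j < n"
      then show "integrable lborel (\<lambda>x. wN i x * x ^ j)"
        using moments[of i j] by (simp add: set_integrable_def wN_def mult_ac)
    qed
    define I where "I = (\<integral>a. q a \<partial>lborel_n n)"
    \<comment> \<open>A zero of the Vandermonde factor forces equal points and hence a zero of the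
      other determinant. So \<open>I = 0\<close> would make that determinant vanish almost
      everywhere, against the box integrals carried over by \<open>e\<close>.\<close>
    have "I \<noteq> 0"
    proof
      assume "I = 0"
      then have "AE a in lborel_n n. q a = 0"
        using integral_nonneg_eq_0_iff_AE[OF int_q] q_nonneg by (simp add: I_def)
      then have ae: "AE a in lborel_n n. det_of n (\<lambda>i j. wN i (a j)) = 0"
      proof eventually_elim
        case (elim a)
        then show ?case
          using vandermonde_eq_0_imp_not_inj[of n a] det_of_not_inj[of a n wN]
          by (auto simp: q_def vandermonde_eq_det)
      qed
      obtain J where J: "\<And>j. J j \<in> sets borel" "det_of n (\<lambda>j c. LINT x:J c|lborel. tv j x) \<noteq> 0"
        using ex_det_integrals_nonzero[of n] n by auto
      have "det_of n (\<lambda>j c. LINT x:J c|lborel. tv j x)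
          = det_of n (\<lambda>j c. \<Sum>k\<le>j. L j k * (LINT x:J c|lborel. v k x))"
      proof (rule det_of_cong)
        fix j c assume j: "j < n"
        have si: "set_integrable lborel (J c) (v k)" if "k \<le> j" for k
          using J that j int_v by (intro set_integrable_if_integrable) auto
        have "(LINT x:J c|lborel. tv j x)
            = (\<integral>x. (\<Sum>k\<le>j. L j k * (indicator (J c) x *\<^sub>R v k x)) \<partial>lborel)"
          by (simp add: tv_def set_lebesgue_integral_def sum_distrib_left mult_ac)
        also have "\<dots> = (\<Sum>k\<le>j. L j k * (LINT x:J c|lborel. v k x))"
          unfolding set_lebesgue_integral_def
          by (subst Bochner_Integration.integral_sum)
             (use si in \<open>auto simp: set_integrable_def intro!: integrable_mult_right\<close>)
        finally show "(LINT x:J c|lborel. tv j x) = (\<Sum>k\<le>j. L j k * (LINT x:J c|lborel. v k x))" .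
      qed
      also have "\<dots> = det_of n (\<lambda>j c. LINT x:J c|lborel. v j x)"
        by (subst det_of_lower_comb) (simp add: L_def)
      also have "\<dots> = det_of n (\<lambda>j c. LINT x:e ` J c|lborel. wN j x)"
      proof (rule det_of_cong)
        fix j c assume "j < n"
        have "(LINT x:e ` J c|lborel. wN j x) = (LINT x:e ` J c|lborel. w j x)"
          using J eJ by (intro set_lebesgue_integral_cong) (auto simp: wN_def eN)
        then show "(LINT x:J c|lborel. v j x) = (LINT x:e ` J c|lborel. wN j x)"
          using subst[OF J(1) \<open>j < n\<close>] by simp
      qed
      also have "\<dots> = 0"
      proof (rule det_of_integrals_eq_0)
        show "integrable lborel (wN j)" if "j < n" for j
          using int_w[OF that] by (simp add: set_integrable_def wN_def[abs_def])
        show "AE a in lborel_n n. (\<forall>j<n. a j \<in> e ` J j) \<longrightarrow> det_of n (\<lambda>i j. wN i (a j)) = 0"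
          using ae by eventually_elim simp
      qed (use J eJ in auto)
      finally show False using J by simp
    qed
    moreover have "0 \<le> I"
      unfolding I_def using q_nonneg by (intro integral_nonneg_AE AE_I2)
    ultimately have "0 < I" by simp
    have ind: "indicator ({..<n} \<rightarrow>\<^sub>E N) a *\<^sub>R ensemble_density n w (1 / I) a = 1 / I * q a"
      if "a \<in> space (lborel_n n)" for a
    proof (cases "\<forall>c<n. a c \<in> N")
      case True
      with that have "a \<in> {..<n} \<rightarrow>\<^sub>E N" by (auto simp: space_PiM PiE_iff)
      with True show ?thesis
        by (simp add: qp p_def ensemble_density_def)
    next
      case False
      then obtain c where "c < n" "a c \<notin> N" by auto
      then have "a \<notin> {..<n} \<rightarrow>\<^sub>E N" by auto
      with q0[of c a, OF \<open>c < n\<close> \<open>a c \<notin> N\<close>] show ?thesis by simp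
    qed
    have "probability_density_on n N (ensemble_density n w (1 / I))"
      unfolding probability_density_on_def
    proof (intro conjI ballI)
      show "0 \<le> ensemble_density n w (1 / I) a" if "a \<in> {..<n} \<rightarrow>\<^sub>E N" for a
        using p_nonneg[of a] that \<open>0 < I\<close>
        by (auto simp: ensemble_density_def p_def zero_le_divide_iff)
      show "set_integrable (lborel_n n) ({..<n} \<rightarrow>\<^sub>E N) (ensemble_density n w (1 / I))"
        unfolding set_integrable_def
        by (subst Bochner_Integration.integrable_cong[OF refl ind]) (auto intro: int_q)
      show "set_lebesgue_integral (lborel_n n) ({..<n} \<rightarrow>\<^sub>E N) (ensemble_density n w (1 / I)) = 1"
        unfolding set_lebesgue_integral_def
        by (subst Bochner_Integration.integral_cong[OF refl ind])
           (use \<open>0 < I\<close> in \<open>auto simp: I_def\<close>)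
    qed
    then show ?thesis using \<open>0 < I\<close> by (intro exI[of _ "1 / I"]) auto
  qed
  ultimately show ?thesis
    unfolding pf_iff by blast
qed

text \<open>Reflection exchanges the two families of points and transposes the matrix, and the
  condition is symmetric in them. This reconciles exp(-x) with the increasing substitution
  exp(u).\<close>

lemma polya_frequency_function_reflect:
  assumes "polya_frequency_function n f"
  shows "polya_frequency_function n (\<lambda>x. f (- x))"
  unfolding polya_frequency_function_def
proof (intro conjI ballI allI)
  have [measurable]: "f \<in> borel_measurable borel"
    using assms by (simp add: polya_frequency_function_def)
  show "(\<lambda>x. f (- x)) \<in> borel_measurable borel"
    by measurable
  fix m x y assume m: "m \<in> {1..n}"
  have "det_of m (\<lambda>b c. f (- (x b - y c))) = det_of m (\<lambda>b c. f (y b - x c))"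
    using det_of_transpose[of m "\<lambda>b c. f (y b - x c)"] by simp
  moreover have "0 \<le> vandermonde m y * vandermonde m x * det_of m (\<lambda>b c. f (y b - x c))"
    using assms m by (auto simp: polya_frequency_function_def)
  ultimately show "0 \<le> vandermonde m x * vandermonde m y * det_of m (\<lambda>b c. f (- (x b - y c)))"
    by (simp add: mult_ac)
qed

lemma L1_weighted_moment:
  assumes f: "f \<in> L1_weighted n N" and "k < n" and [measurable]: "N \<in> sets borel"
  shows "set_integrable lborel N (\<lambda>x. x ^ k * f x)"
\<comment> \<open>\<open>0 powr 0\<close> is 0 whereas \<open>0 ^ 0\<close> is 1, so the zeroth
  moment is taken from plain integrability; otherwise \<kappa> = k + 1 is the exponent used.\<close>
proof (cases "k = 0")
  case True
  then show ?thesis using f by (simp add: L1_weighted_def)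
next
  case False
  have si: "set_integrable lborel N f" using f by (simp add: L1_weighted_def)
  have [measurable]: "(\<lambda>x. indicator N x * f x) \<in> borel_measurable borel"
    using borel_measurable_integrable[OF si[unfolded set_integrable_def]] by simp
  have "(\<lambda>x. x ^ k * (indicator N x * f x)) \<in> borel_measurable borel"
    by measurable
  then have "set_borel_measurable lborel N (\<lambda>x. x ^ k * f x)"
    by (simp add: set_borel_measurable_def mult_ac)
  moreover have "real k + 1 \<in> {1..real n}" using \<open>k < n\<close> by auto
  then have "set_integrable lborel N (\<lambda>x. \<bar>x\<bar> powr real k * \<bar>f x\<bar>)"
    using f unfolding L1_weighted_def by fastforce
  ultimately show ?thesis
    using False by (rule_tac set_integrable_bound)
      (auto simp: abs_mult power_abs powr_realpow')
qed

section \<open>The weights\<close>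

lemma times_differentiable_on_has_derivative:
  assumes "times_differentiable_on k f S" "open S" "j < k" "x \<in> S"
  shows "((deriv ^^ j) f has_real_derivative (deriv ^^ Suc j) f x) (at x)"
proof -
  have "(deriv ^^ j) f differentiable (at x)"
    using assms by (auto simp: times_differentiable_on_def differentiable_on_def at_within_open[OF _ assms(2)])
  then have "((deriv ^^ j) f has_real_derivative deriv ((deriv ^^ j) f) x) (at x)"
    by (auto simp: real_differentiable_def dest: DERIV_imp_deriv)
  then show ?thesis by simp
qed

lemma has_derivative_if_eq_on_open:
  assumes "(f has_real_derivative D) (at x)" "open S" "x \<in> S" "\<And>y. y \<in> S \<Longrightarrow> f y = g y"
  shows "(g has_real_derivative D) (at x)"
  using has_field_derivative_transform_within_open[OF assms(1,2,3)] assms(4) by blast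

lemma weights_H2_eq:
  assumes "times_differentiable_on k \<omega> UNIV" "j \<le> k"
  shows "weights_H2 \<omega> j = (\<lambda>x. (-1) ^ j * (deriv ^^ j) \<omega> x)"
  using assms(2)
proof (induction j)
  case (Suc j)
  have "((\<lambda>x. (-1) ^ j * (deriv ^^ j) \<omega> x) has_real_derivative (-1) ^ j * (deriv ^^ Suc j) \<omega> x) (at x)" for x
    using Suc.prems by (intro DERIV_cmult times_differentiable_on_has_derivative[OF assms(1)]) auto
  then have "deriv (weights_H2 \<omega> j) x = (-1) ^ j * (deriv ^^ Suc j) \<omega> x" for x
    using Suc by (simp add: DERIV_imp_deriv)
  moreover have "weights_H2 \<omega> (Suc j) = (\<lambda>x. - deriv (weights_H2 \<omega> j) x)"
    by (simp add: weights_H2_def)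
  ultimately show ?case by auto
qed (simp add: weights_H2_def)

text \<open>Differentiability is given for the ordinary derivatives, while the weights are iterates
  of x d/dx. This expansion transfers it.\<close>

lemma Euler_derivative_expansion:
  fixes D :: "(real \<Rightarrow> real) \<Rightarrow> real \<Rightarrow> real"
  defines "D \<equiv> \<lambda>g x. x * deriv g x"
  assumes diff: "times_differentiable_on k \<omega> S" and S: "open S" and "j \<le> k"
  shows "\<exists>c. \<forall>x\<in>S. (D ^^ j) \<omega> x = (\<Sum>i\<le>j. c i * x ^ i * (deriv ^^ i) \<omega> x)"
  using \<open>j \<le> k\<close>
proof (induction j)
  case 0
  show ?case by (intro exI[of _ "\<lambda>_. 1"]) simp
next
  case (Suc j)
  then obtain c where c: "\<And>x. x \<in> S \<Longrightarrow> (D ^^ j) \<omega> x = (\<Sum>i\<le>j. c i * x ^ i * (deriv ^^ i) \<omega> x)"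
    by auto
  \<comment> \<open>The recursion of the Stirling numbers of the second kind; \<open>c\<close> is
    meaningful up to \<open>j\<close>, hence the guard.\<close>
  define c' where "c' i = (if i \<le> j then real i * c i else 0) + (if i = 0 then 0 else c (i - 1))" for i
  have "(D ^^ Suc j) \<omega> x = (\<Sum>i\<le>Suc j. c' i * x ^ i * (deriv ^^ i) \<omega> x)" if x: "x \<in> S" for x
  proof -
    let ?d = "\<lambda>i. (deriv ^^ i) \<omega> x"
    have "((\<lambda>x. \<Sum>i\<le>j. c i * (x ^ i * (deriv ^^ i) \<omega> x)) has_real_derivative
        (\<Sum>i\<le>j. c i * (real i * x ^ (i - Suc 0) * ?d i + ?d (Suc i) * x ^ i))) (at x)"
      using Suc.prems
      by (intro DERIV_sum DERIV_cmult DERIV_mult times_differentiable_on_has_derivative[OF diff S _ x]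
          DERIV_pow) auto
    then have "((D ^^ j) \<omega> has_real_derivative
        (\<Sum>i\<le>j. c i * (real i * x ^ (i - Suc 0) * ?d i + ?d (Suc i) * x ^ i))) (at x)"
      by (rule has_derivative_if_eq_on_open[OF _ S x]) (simp add: c mult.assoc)
    then have "(D ^^ Suc j) \<omega> x
        = x * (\<Sum>i\<le>j. c i * (real i * x ^ (i - Suc 0) * ?d i + ?d (Suc i) * x ^ i))"
      by (simp add: D_def DERIV_imp_deriv)
    also have "\<dots> = (\<Sum>i\<le>j. real i * c i * x ^ i * ?d i + c i * x ^ Suc i * ?d (Suc i))"
      unfolding sum_distrib_left
    proof (intro sum.cong refl)
      fix i
      show "x * (c i * (real i * x ^ (i - Suc 0) * ?d i + ?d (Suc i) * x ^ i))
          = real i * c i * x ^ i * ?d i + c i * x ^ Suc i * ?d (Suc i)"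
        by (cases i) (simp_all add: algebra_simps)
    qed
    also have "\<dots> = (\<Sum>i\<le>Suc j. (if i \<le> j then real i * c i else 0) * x ^ i * ?d i)
        + (\<Sum>i\<le>Suc j. (if i = 0 then 0 else c (i - 1)) * x ^ i * ?d i)"
      by (subst (2) sum.atMost_Suc_shift) (simp add: sum.distrib)
    also have "\<dots> = (\<Sum>i\<le>Suc j. c' i * x ^ i * ?d i)"
      unfolding c'_def by (simp add: sum.distrib[symmetric] algebra_simps del: sum.atMost_Suc)
    finally show ?thesis .
  qed
  then show ?case by blast
qed

lemma Euler_derivative_has_derivative:
  fixes D :: "(real \<Rightarrow> real) \<Rightarrow> real \<Rightarrow> real"
  defines "D \<equiv> \<lambda>g x. x * deriv g x"
  assumes diff: "times_differentiable_on k \<omega> S" and S: "open S" and "j < k" and x: "x \<in> S"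
  shows "((D ^^ j) \<omega> has_real_derivative deriv ((D ^^ j) \<omega>) x) (at x)"
proof -
  obtain c where c: "\<And>x. x \<in> S \<Longrightarrow> (D ^^ j) \<omega> x = (\<Sum>i\<le>j. c i * x ^ i * (deriv ^^ i) \<omega> x)"
    using Euler_derivative_expansion[OF diff S, of j] \<open>j < k\<close> unfolding D_def by auto
  have "((\<lambda>x. \<Sum>i\<le>j. c i * (x ^ i * (deriv ^^ i) \<omega> x)) has_real_derivative
      (\<Sum>i\<le>j. c i * (real i * x ^ (i - Suc 0) * (deriv ^^ i) \<omega> x + (deriv ^^ Suc i) \<omega> x * x ^ i))) (at x)"
    using \<open>j < k\<close>
    by (intro DERIV_sum DERIV_cmult DERIV_mult times_differentiable_on_has_derivative[OF diff S _ x]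
        DERIV_pow) auto
  from has_derivative_if_eq_on_open[OF this S x, of "(D ^^ j) \<omega>"] show ?thesis
    by (metis (no_types, lifting) DERIV_imp_deriv c mult.assoc sum.cong)
qed

lemma weights_G_eq:
  assumes "times_differentiable_on k \<omega> {0<..}" "j \<le> k" "0 < x"
  shows "weights_G \<omega> j x = (-1) ^ j * ((\<lambda>g x. x * deriv g x) ^^ j) \<omega> x"
  using assms(2,3)
proof (induction j arbitrary: x)
  case (Suc j)
  let ?D = "\<lambda>(g :: real \<Rightarrow> real) x. x * deriv g x"
  have "((?D ^^ j) \<omega> has_real_derivative deriv ((?D ^^ j) \<omega>) x) (at x)"
    using Suc.prems by (intro Euler_derivative_has_derivative[OF assms(1)]) auto
  then have "((\<lambda>x. (-1) ^ j * (?D ^^ j) \<omega> x) has_real_derivative (-1) ^ j * deriv ((?D ^^ j) \<omega>) x) (at x)"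
    by (rule DERIV_cmult)
  then have "(weights_G \<omega> j has_real_derivative (-1) ^ j * deriv ((?D ^^ j) \<omega>) x) (at x)"
    by (rule has_derivative_if_eq_on_open[where S = "{0<..}"]) (use Suc in auto)
  then have "deriv (weights_G \<omega> j) x = (-1) ^ j * deriv ((?D ^^ j) \<omega>) x"
    by (rule DERIV_imp_deriv)
  moreover have "weights_G \<omega> (Suc j) x = - x * deriv (weights_G \<omega> j) x"
    by (simp add: weights_G_def)
  ultimately show ?case by simp
qed (simp add: weights_G_def)

section \<open>The Hermitian and the multiplicative case\<close>

lemma polya_ensemble_H2_iff:
  assumes n: "2 \<le> n" and \<omega>: "\<omega> \<in> L1_H2 n" and nz: "\<exists>x. \<omega> x \<noteq> 0"
  shows "gives_rise_to_polya_ensemble_H2 n \<omega> \<longleftrightarrow> polya_frequency_function n \<omega>"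
proof -
  have td: "times_differentiable_on (n - 1) \<omega> UNIV"
    using \<omega> by (simp add: L1_H2_def)
  have w: "weights_H2 \<omega> j = (\<lambda>x. (-1) ^ j * (deriv ^^ j) \<omega> x)" if "j < n" for j
    using that by (intro weights_H2_eq[OF td]) auto
  have "(\<exists>C>0. probability_density_on n UNIV (ensemble_density n (weights_H2 \<omega>) C))
    \<longleftrightarrow> polya_frequency_function n (\<lambda>u. weights_H2 \<omega> 0 (id u) * 1)"
  proof (rule polya_ensemble_iff_polya_frequency[where l = id and lam = 0, OF n])
    fix j u assume j: "Suc j < n"
    have "((\<lambda>x. (-1) ^ j * (deriv ^^ j) \<omega> x) has_real_derivative (-1) ^ j * (deriv ^^ Suc j) \<omega> u) (at u)"
      using j by (intro DERIV_cmult times_differentiable_on_has_derivative[OF td]) auto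
    then show "((\<lambda>u. weights_H2 \<omega> j (id u) * 1) has_real_derivative
        0 * (weights_H2 \<omega> j (id u) * 1) - weights_H2 \<omega> (Suc j) (id u) * 1) (at u)"
      using j by (simp add: w)
  next
    fix j k assume jk: "j < n" "k < n"
    then have "(deriv ^^ j) \<omega> \<in> L1_weighted n UNIV"
      using \<omega> by (auto simp: L1_H2_def)
    then have "set_integrable lborel UNIV (\<lambda>x. x ^ k * (deriv ^^ j) \<omega> x)"
      using jk by (intro L1_weighted_moment) auto
    then have "set_integrable lborel UNIV (\<lambda>x. (-1) ^ j * (x ^ k * (deriv ^^ j) \<omega> x))"
      by (rule set_integrable_mult_right)
    then show "set_integrable lborel UNIV (\<lambda>x. x ^ k * weights_H2 \<omega> j x)"
      using jk by (simp add: w mult_ac)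
  qed (use \<omega> nz in \<open>auto simp: weights_H2_def L1_H2_def id_def\<close>)
  then show ?thesis
    by (simp add: gives_rise_to_polya_ensemble_H2_def weights_H2_def)
qed

lemma polya_ensemble_G_iff:
  assumes n: "2 \<le> n" and \<omega>: "\<omega> \<in> L1_G n" and nz: "\<exists>x>0. \<omega> x \<noteq> 0"
  shows "gives_rise_to_polya_ensemble_G n \<omega>
    \<longleftrightarrow> polya_frequency_function n (\<lambda>x. \<omega> (exp (- x)) * exp (- x))"
proof -
  let ?D = "\<lambda>(g :: real \<Rightarrow> real) x. x * deriv g x"
  have td: "times_differentiable_on (n - 1) \<omega> {0<..}"
    using \<omega> by (simp add: L1_G_def)
  have w: "weights_G \<omega> j x = (-1) ^ j * (?D ^^ j) \<omega> x" if "j < n" "0 < x" for j x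
    using that by (intro weights_G_eq[OF td]) auto
  have "(\<exists>C>0. probability_density_on n {0<..} (ensemble_density n (weights_G \<omega>) C))
    \<longleftrightarrow> polya_frequency_function n (\<lambda>u. weights_G \<omega> 0 (exp u) * exp u)"
  proof (rule polya_ensemble_iff_polya_frequency[where l = ln and lam = 1, OF n])
    fix j and u :: real assume j: "Suc j < n"
    define x where "x = exp u"
    have "0 < x" by (simp add: x_def)
    have "((\<lambda>x. (-1) ^ j * (?D ^^ j) \<omega> x) has_real_derivative (-1) ^ j * deriv ((?D ^^ j) \<omega>) x) (at x)"
      using j \<open>0 < x\<close> by (intro DERIV_cmult Euler_derivative_has_derivative[OF td]) auto
    then have d: "(weights_G \<omega> j has_real_derivative (-1) ^ j * deriv ((?D ^^ j) \<omega>) x) (at x)"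
      by (rule has_derivative_if_eq_on_open[where S = "{0<..}"]) (use \<open>0 < x\<close> j w in auto)
    have "weights_G \<omega> (Suc j) x = - ((-1) ^ j * deriv ((?D ^^ j) \<omega>) x) * x"
      using j \<open>0 < x\<close> by (simp add: w)
    moreover have "((\<lambda>u. weights_G \<omega> j (exp u)) has_real_derivative
        ((-1) ^ j * deriv ((?D ^^ j) \<omega>) x) * exp u) (at u)"
      using DERIV_chain2[OF d[unfolded x_def] DERIV_exp] by (simp add: x_def)
    \<comment> \<open>The Jacobian factor \<open>exp u\<close> reproduces the function itself under
      the product rule, which is the origin of \<open>lam = 1\<close>; the other term is minus the
      next weight.\<close>
    from DERIV_mult[OF this DERIV_exp]
    have "((\<lambda>u. weights_G \<omega> j (exp u) * exp u) has_real_derivative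
        ((-1) ^ j * deriv ((?D ^^ j) \<omega>) x) * x * x + weights_G \<omega> j x * x) (at u)"
      by (simp add: x_def mult_ac)
    ultimately show "((\<lambda>u. weights_G \<omega> j (exp u) * exp u) has_real_derivative
        1 * (weights_G \<omega> j (exp u) * exp u) - weights_G \<omega> (Suc j) (exp u) * exp u) (at u)"
      by (simp add: x_def add.commute)
  next
    fix j k assume jk: "j < n" "k < n"
    then have "(?D ^^ j) \<omega> \<in> L1_weighted n {0<..}"
      using \<omega> by (auto simp: L1_G_def)
    then have "set_integrable lborel {0<..} (\<lambda>x. x ^ k * (?D ^^ j) \<omega> x)"
      using jk by (intro L1_weighted_moment) auto
    then have "set_integrable lborel {0<..} (\<lambda>x. (-1) ^ j * (x ^ k * (?D ^^ j) \<omega> x))"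
      by (rule set_integrable_mult_right)
    moreover have "set_integrable lborel {0<..} (\<lambda>x. (-1) ^ j * (x ^ k * (?D ^^ j) \<omega> x))
        \<longleftrightarrow> set_integrable lborel {0<..} (\<lambda>x. x ^ k * weights_G \<omega> j x)"
      using jk by (intro set_integrable_cong) (auto simp: w)
    ultimately show "set_integrable lborel {0<..} (\<lambda>x. x ^ k * weights_G \<omega> j x)"
      by blast
  next
    show "{0<..} = range (exp :: real \<Rightarrow> real)"
      by (auto simp: image_iff) (metis exp_ln)
  qed (use \<omega> nz in \<open>auto simp: weights_G_def L1_G_def intro: DERIV_exp\<close>)
  also have "\<dots> \<longleftrightarrow> polya_frequency_function n (\<lambda>u. \<omega> (exp (- u)) * exp (- u))"
    using polya_frequency_function_reflect[of n "\<lambda>u. \<omega> (exp u) * exp u"]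
      polya_frequency_function_reflect[of n "\<lambda>u. \<omega> (exp (- u)) * exp (- u)"]
    by (auto simp: weights_G_def)
  finally show ?thesis
    by (simp add: gives_rise_to_polya_ensemble_G_def)
qed

theorem theorem2p9:
  fixes n :: nat
  assumes "n \<ge> 2"
  shows "(\<forall>\<omega> \<in> L1_H2 n. (\<exists>x. \<omega> x \<noteq> 0) \<longrightarrow>
            (gives_rise_to_polya_ensemble_H2 n \<omega> \<longleftrightarrow> polya_frequency_function n \<omega>))
       \<and> (\<forall>\<omega> \<in> L1_G n. (\<exists>x>0. \<omega> x \<noteq> 0) \<longrightarrow>
            (gives_rise_to_polya_ensemble_G n \<omega> \<longleftrightarrow>
             polya_frequency_function n (\<lambda>x. \<omega> (exp (- x)) * exp (- x))))"
  using polya_ensemble_H2_iff[OF assms] polya_ensemble_G_iff[OF assms] by blast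

end
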